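(* Let $-\infty\le a<b\le\infty$, $m,n_1,n_2\in\mathbb{N}$, $n=n_1+n_2$, and let $f_j\in L^2((a,b);dx)^{m\times n_j}$, $g_j\in L^2((a,b);dx)^{n_j\times m}$, $j=1,2$. Let $\alpha\in\mathbb{C}$. With $H$, $A$, $B$, $C$, $K$, $\hat f_1(\cdot,\alpha)$, $\hat f_2(\cdot,\alpha)$ as in the context, the following hold. (i) The $n\times n$ matrix function $$U(x,\alpha)=\begin{pmatrix} I_{n_1}-\alpha\int_x^b dx'\,g_1(x')\hat f_1(x',\alpha) & \alpha\int_a^x dx'\,g_1(x')\hat f_2(x',\alpha)\\ \alpha\int_x^b dx'\,g_2(x')\hat f_1(x',\alpha) & I_{n_2}-\alpha\int_a^x dx'\,g_2(x')\hat f_2(x',\alpha)\end{pmatrix},\quad x\in(a,b),$$ is a solution of the first-order system $U'(x,\alpha)=\alpha A(x)U(x,\alpha)$ for a.e. $x\in(a,b)$. Moreover, the two conditions $$\det\nolimits_{\mathbb{C}^{n_1}}\Big(I_{n_1}-\alpha\int_a^b dx\,g_1(x)\hat f_1(x,\alpha)\Big)\ne0 \quad\text{and}\quad \det\nolimits_{\mathbb{C}^{n_2}}\Big(I_{n_2}-\alpha\int_a^b dx\,g_2(x)\hat f_2(x,\alpha)\Big)\neq 0$$ are equivalent, and if they hold, then $U(x,\alpha)$ is nonsingular for all $x\in(a,b)$ and the general ($n\times n$ matrix-valued, locally absolutely continuous) solution $V$ of $V'=\alpha AV$ a.e. on $(a,b)$ is of the form $V=UD$ with $D$ a constant $n\times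 n$ matrix. (ii) Assume the equivalent conditions in (i), and choose the matrix function $U(\cdot,\alpha)$ defined by the explicit formula in (i), in terms of $\hat f_1(\cdot,\alpha)$ and $\hat f_2(\cdot,\alpha)$, as the nonsingular solution in the representation of $(I-\alpha K)^{-1}$ recalled in the context. Then the matrix $P(\alpha)$ determined by $$P_0U(b,\alpha)(I_n-P(\alpha))=(I_n-P_0)U(a,\alpha)P(\alpha),\qquad P_0=\begin{pmatrix}0&0\\0&I_{n_2}\end{pmatrix},$$ is $P(\alpha)=P_0$.
   Context: Notation: $I_k$ is the $k\times k$ identity matrix, $I$ the identity operator in $L^2((a,b);dx)^m$. The kernel $H$ is $H(x,x')=f_1(x)g_1(x')-f_2(x)g_2(x')$ (an $m\times m$ matrix). The functions $\hat f_j(\cdot,\alpha)\in L^2((a,b);dx)^{m\times n_j}$ are the solutions of the Volterra integral equations $$\hat f_1(x,\alpha)=f_1(x)-\alpha\int_x^b dx'\,H(x,x')\hat f_1(x',\alpha),\qquad \hat f_2(x,\alpha)=f_2(x)+\alpha\int_a^x dx'\,H(x,x')\hat f_2(x',\alpha).$$ $C(x)=(f_1(x)\;\;f_2(x))$ is $m\times n$, $B(x)$ is the $n\times m$ block column with blocks $g_1(x)$ (top) and $-g_2(x)$ (bottom), and $$A(x)=B(x)C(x)=\begin{pmatrix} g_1(x)f_1(x)&g_1(x)f_2(x)\\-g_2(x)f_1(x)&-g_2(x)f_2(x)\end{pmatrix}.$$ $U(a,\alpha)$ and $U(b,\alpha)$ are the values of the defining formula for $U$ at $x=a$ and $x=b$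 (equivalently, the limits $x\downarrow a$, $x\uparrow b$). $K$ is the Hilbert–Schmidt operator in $L^2((a,b);dx)^m$ with integral kernel $K(x,x')=f_1(x)g_1(x')$ for $a<x'<x<b$ and $K(x,x')=f_2(x)g_2(x')$ for $a<x<x'<b$. For a nonsingular solution $U$ of $U'=\alpha AU$, the resolvent representation referred to in (ii) is $(I-\alpha K)^{-1}=I+\alpha L(\alpha)$, where $L(\alpha)$ is the integral operator with kernel $$L(x,x',\alpha)=\begin{cases} C(x)U(x,\alpha)(I_n-P(\alpha))U(x',\alpha)^{-1}B(x'),& a<x'<x<b,\\ -C(x)U(x,\alpha)P(\alpha)U(x',\alpha)^{-1}B(x'),& a<x<x'<b,\end{cases}$$ and the $n\times n$ matrix $P(\alpha)$ satisfies the equation displayed in (ii). *)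

theory Defs
  imports "HOL-Analysis.Analysis"
begin

section \<open>Matrices\<close>

text \<open>
  A \<open>k \<times> l\<close> complex matrix is an element of \<open>complex ^ 'l ^ 'k\<close>. For \<open>n = n\<^sub>1 + n\<^sub>2\<close> the index
  type is the disjoint sum \<open>'n1 + 'n2\<close>, with the \<open>Inl\<close> indices belonging to the first block.
\<close>

definition cscale :: "complex \<Rightarrow> complex ^ 'l ^ 'k \<Rightarrow> complex ^ 'l ^ 'k"  (infixr \<open>*\<^sub>c\<close> 75)
  where "c *\<^sub>c M = (\<chi> i j. c * M $ i $ j)"

definition row_block :: "'a ^ 'p ^ 'k \<Rightarrow> 'a ^ 'q ^ 'k \<Rightarrow> 'a ^ ('p + 'q) ^ 'k"
  where "row_block M N = (\<chi> i j. case j of Inl l \<Rightarrow> M $ i $ l | Inr l \<Rightarrow> N $ i $ l)"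

definition col_block :: "'a ^ 'k ^ 'p \<Rightarrow> 'a ^ 'k ^ 'q \<Rightarrow> 'a ^ 'k ^ ('p + 'q)"
  where "col_block M N = (\<chi> i. case i of Inl l \<Rightarrow> M $ l | Inr l \<Rightarrow> N $ l)"

definition block_matrix ::
  "'a ^ 'p ^ 'p \<Rightarrow> 'a ^ 'q ^ 'p \<Rightarrow> 'a ^ 'p ^ 'q \<Rightarrow> 'a ^ 'q ^ 'q \<Rightarrow> 'a ^ ('p + 'q) ^ ('p + 'q)"
  where "block_matrix M11 M12 M21 M22 = col_block (row_block M11 M12) (row_block M21 M22)"


section \<open>Square-integrable and locally absolutely continuous functions\<close>

text \<open>
  The norm of \<open>complex ^ 'l ^ 'k\<close> is the Frobenius norm, so for matrix-valued \<open>f\<close> this says that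
  every entry of \<open>f\<close> is in \<open>L\<^sup>2\<close>. Functions equal almost everywhere are not identified;
  equality in \<open>L\<^sup>2\<close> is written out as equality almost everywhere.
\<close>

definition L2_on :: "real set \<Rightarrow> (real \<Rightarrow> 'v::euclidean_space) \<Rightarrow> bool"
  where "L2_on J f \<longleftrightarrow>
    set_borel_measurable lebesgue J f \<and> set_integrable lebesgue J (\<lambda>x. (norm (f x))\<^sup>2)"

definition absolutely_continuous_on_interval ::
  "real \<Rightarrow> real \<Rightarrow> (real \<Rightarrow> 'v::real_normed_vector) \<Rightarrow> bool"
  where "absolutely_continuous_on_interval c d f \<longleftrightarrow>
    (\<forall>\<epsilon>>0. \<exists>\<delta>>0. \<forall>(N::nat) u v.
       (\<forall>i<N. c \<le> u i \<and> u i \<le> v i \<and> v i \<le> d) \<and>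
       (\<forall>i<N. \<forall>j<N. i \<noteq> j \<longrightarrow> {u i<..<v i} \<inter> {u j<..<v j} = {}) \<and>
       (\<Sum>i<N. v i - u i) < \<delta>
       \<longrightarrow> (\<Sum>i<N. norm (f (v i) - f (u i))) < \<epsilon>)"

definition locally_absolutely_continuous_on :: "real set \<Rightarrow> (real \<Rightarrow> 'v::real_normed_vector) \<Rightarrow> bool"
  where "locally_absolutely_continuous_on J f \<longleftrightarrow>
    (\<forall>c d. {c..d} \<subseteq> J \<longrightarrow> absolutely_continuous_on_interval c d f)"

text \<open>Solutions of \<open>V' = \<alpha> A V\<close> almost everywhere on \<open>J\<close>.\<close>

definition is_solution_on ::
  "real set \<Rightarrow> complex \<Rightarrow> (real \<Rightarrow> complex ^ 'n ^ 'n) \<Rightarrow> (real \<Rightarrow> complex ^ 'n ^ 'n) \<Rightarrow> bool"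
  where "is_solution_on J \<alpha> A V \<longleftrightarrow>
    locally_absolutely_continuous_on J V \<and>
    (AE x\<in>J in lebesgue. (V has_vector_derivative \<alpha> *\<^sub>c (A x ** V x)) (at x))"


section \<open>Semi-separable kernels\<close>

definition H_kernel ::
  "(real \<Rightarrow> complex ^ 'n1 ^ 'm) \<Rightarrow> (real \<Rightarrow> complex ^ 'n2 ^ 'm) \<Rightarrow>
   (real \<Rightarrow> complex ^ 'm ^ 'n1) \<Rightarrow> (real \<Rightarrow> complex ^ 'm ^ 'n2) \<Rightarrow>
   real \<Rightarrow> real \<Rightarrow> complex ^ 'm ^ 'm"
  where "H_kernel f1 f2 g1 g2 x y = f1 x ** g1 y - f2 x ** g2 y"

definition C_matrix ::
  "(real \<Rightarrow> complex ^ 'n1 ^ 'm) \<Rightarrow> (real \<Rightarrow> complex ^ 'n2 ^ 'm) \<Rightarrow> real \<Rightarrow> complex ^ ('n1 + 'n2) ^ 'm"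
  where "C_matrix f1 f2 x = row_block (f1 x) (f2 x)"

definition B_matrix ::
  "(real \<Rightarrow> complex ^ 'm ^ 'n1) \<Rightarrow> (real \<Rightarrow> complex ^ 'm ^ 'n2) \<Rightarrow> real \<Rightarrow> complex ^ 'm ^ ('n1 + 'n2)"
  where "B_matrix g1 g2 x = col_block (g1 x) (- g2 x)"

definition A_matrix ::
  "(real \<Rightarrow> complex ^ 'n1 ^ 'm) \<Rightarrow> (real \<Rightarrow> complex ^ 'n2 ^ 'm) \<Rightarrow>
   (real \<Rightarrow> complex ^ 'm ^ 'n1) \<Rightarrow> (real \<Rightarrow> complex ^ 'm ^ 'n2) \<Rightarrow>
   real \<Rightarrow> complex ^ ('n1 + 'n2) ^ ('n1 + 'n2)"
  where "A_matrix f1 f2 g1 g2 x = B_matrix g1 g2 x ** C_matrix f1 f2 x"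

text \<open>
  The argument \<open>x\<close> of \<open>U_matrix\<close> is an extended real, so that the same formula also gives the
  values at the (possibly infinite) endpoints \<open>a\<close> and \<open>b\<close>. Here \<open>h1\<close> and \<open>h2\<close> stand for the
  solutions of the two Volterra equations.
\<close>

definition U_matrix ::
  "complex \<Rightarrow> ereal \<Rightarrow> ereal \<Rightarrow>
   (real \<Rightarrow> complex ^ 'm ^ 'n1) \<Rightarrow> (real \<Rightarrow> complex ^ 'm ^ 'n2) \<Rightarrow>
   (real \<Rightarrow> complex ^ 'n1 ^ 'm) \<Rightarrow> (real \<Rightarrow> complex ^ 'n2 ^ 'm) \<Rightarrow>
   ereal \<Rightarrow> complex ^ ('n1 + 'n2) ^ ('n1 + 'n2)"
  where "U_matrix \<alpha> a b g1 g2 h1 h2 x = block_matrix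
    (mat 1 - \<alpha> *\<^sub>c (LINT y:einterval x b|lebesgue. g1 y ** h1 y))
    (\<alpha> *\<^sub>c (LINT y:einterval a x|lebesgue. g1 y ** h2 y))
    (\<alpha> *\<^sub>c (LINT y:einterval x b|lebesgue. g2 y ** h1 y))
    (mat 1 - \<alpha> *\<^sub>c (LINT y:einterval a x|lebesgue. g2 y ** h2 y))"

definition P0_matrix :: "complex ^ ('n1::finite + 'n2::finite) ^ ('n1 + 'n2)"
  where "P0_matrix = block_matrix 0 0 0 (mat 1)"

text \<open>The values of the following two kernels on the diagonal are irrelevant; they are set to \<open>0\<close>.\<close>

definition K_kernel ::
  "(real \<Rightarrow> complex ^ 'n1 ^ 'm) \<Rightarrow> (real \<Rightarrow> complex ^ 'n2 ^ 'm) \<Rightarrow>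
   (real \<Rightarrow> complex ^ 'm ^ 'n1) \<Rightarrow> (real \<Rightarrow> complex ^ 'm ^ 'n2) \<Rightarrow>
   real \<Rightarrow> real \<Rightarrow> complex ^ 'm ^ 'm"
  where "K_kernel f1 f2 g1 g2 x y =
    (if y < x then f1 x ** g1 y else if x < y then f2 x ** g2 y else 0)"

definition L_kernel ::
  "(real \<Rightarrow> complex ^ 'n ^ 'm) \<Rightarrow> (real \<Rightarrow> complex ^ 'm ^ 'n) \<Rightarrow>
   (real \<Rightarrow> complex ^ 'n ^ 'n) \<Rightarrow> complex ^ 'n ^ 'n \<Rightarrow>
   real \<Rightarrow> real \<Rightarrow> complex ^ 'm ^ 'm"
  where "L_kernel C B U P x y =
    (if y < x then C x ** U x ** (mat 1 - P) ** matrix_inv (U y) ** B y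
     else if x < y then - (C x ** U x ** P ** matrix_inv (U y) ** B y) else 0)"

definition integral_operator ::
  "real set \<Rightarrow> (real \<Rightarrow> real \<Rightarrow> complex ^ 'm ^ 'm) \<Rightarrow> (real \<Rightarrow> complex ^ 'm) \<Rightarrow> real \<Rightarrow> complex ^ 'm"
  where "integral_operator J k \<phi> x = (LINT y:J|lebesgue. k x y *v \<phi> y)"

text \<open>\<open>S\<close> and \<open>T\<close> are everywhere defined on \<open>L\<^sup>2(J)\<^sup>m\<close>, and \<open>S\<^sup>-\<^sup>1 = T\<close>.\<close>

definition L2_inverse_operators ::
  "real set \<Rightarrow> ((real \<Rightarrow> complex ^ 'm) \<Rightarrow> real \<Rightarrow> complex ^ 'm) \<Rightarrow>
   ((real \<Rightarrow> complex ^ 'm) \<Rightarrow> real \<Rightarrow> complex ^ 'm) \<Rightarrow> bool"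
  where "L2_inverse_operators J S T \<longleftrightarrow>
    (\<forall>\<phi>. L2_on J \<phi> \<longrightarrow>
       L2_on J (S \<phi>) \<and> L2_on J (T \<phi>) \<and>
       (AE x\<in>J in lebesgue. T (S \<phi>) x = \<phi> x) \<and>
       (AE x\<in>J in lebesgue. S (T \<phi>) x = \<phi> x))"

end

theory Submission
  imports Defs
begin

text \<open>
  The Volterra equations say that the block row of \<open>fh1\<close> and \<open>fh2\<close> is \<open>C U\<close>, so the formula for
  \<open>U\<close> is the integrated form of \<open>U' = \<alpha> A U\<close>, valid up to the (possibly infinite) endpoints. Since
  \<open>A\<close> is integrable, a solution vanishing at one point of \<open>[a, b]\<close> vanishes on all of it; hence
  \<open>U x\<close> is singular for one \<open>x\<close> iff it is for all, and \<open>U a\<close> and \<open>U b\<close> are block triangular with the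
  two given matrices as their only nontrivial diagonal blocks. Block triangularity also gives
  \<open>U a P\<^sub>0 = P\<^sub>0\<close> and \<open>U b (1 - P\<^sub>0) = 1 - P\<^sub>0\<close>, from which \<open>P = P\<^sub>0\<close> follows.

  For the resolvent, \<open>K \<phi> = C z\<close>, where \<open>z\<close> is the primitive of \<open>B \<phi>\<close> with the boundary conditions
  \<open>(1 - P\<^sub>0) z a = 0\<close> and \<open>P\<^sub>0 z b = 0\<close>. Similarly \<open>L \<phi> = C U w\<close>, where \<open>w\<close> is such a primitive of
  \<open>U\<^sup>-\<^sup>1 B \<phi>\<close>; by variation of constants \<open>U w\<close> is the primitive belonging to \<open>(1 + \<alpha> L) \<phi>\<close>, so
  \<open>(1 - \<alpha> K) (1 + \<alpha> L) = 1\<close>. If \<open>(1 - \<alpha> K) \<phi> = 0\<close>, then \<open>z' = \<alpha> A z\<close>, so \<open>z = U d\<close>, and the boundary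
  conditions force \<open>d = 0\<close>; thus \<open>1 - \<alpha> K\<close> is injective and the right inverse is two-sided.
\<close>

section \<open>Integrals over intervals with extended real endpoints\<close>

text \<open>The endpoints may be infinite and the coefficients are merely integrable, so initial
  value theory at interior points does not reach the boundary conditions, which live at
  \<open>a\<close> and \<open>b\<close>. Therefore \<open>U\<close> is a function of an extended
  real: on the compact interval \<open>{a..b}\<close> its integrated equation holds throughout, and
  continuity there bounds \<open>U\<close> and its inverse. The differential equations hold only
  almost everywhere and only inside \<open>J\<close>. Passing to them needs Lebesgue
  differentiation; passing back needs the fundamental theorem for absolutely continuous functions,
  because variation of constants differentiates the product \<open>U w\<close>, and an arbitrary
  solution \<open>V\<close> is known only through absolute continuity and its derivative. The
  operator \<open>K\<close> has the form of \<open>L\<close> with \<open>U\<close> replaced by the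
  constant matrix 1 and \<open>P = P\<^sub>0\<close>, so one formula serves both. Uniqueness of
  \<open>P\<close> and injectivity of \<open>1 - \<alpha> K\<close> rest on the same fact: no
  nonzero \<open>d\<close> makes \<open>U d\<close> satisfy both boundary conditions.\<close>

lemma einterval_lebesgue [simp, measurable]: "einterval a b \<in> sets lebesgue"
  by simp

lemma einterval_mono: "a' \<le> a \<Longrightarrow> b \<le> b' \<Longrightarrow> einterval a b \<subseteq> einterval a' b'"
  by (auto simp: einterval_iff)

lemma Icc_subset_einterval:
  assumes "c \<in> einterval a b" "d \<in> einterval a b"
  shows "{c..d} \<subseteq> einterval a b"
proof
  fix x assume "x \<in> {c..d}"
  then show "x \<in> einterval a b"
    using assms less_le_trans[of a "ereal c" "ereal x"] le_less_trans[of "ereal x" "ereal d" b]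
    by (simp add: einterval_iff)
qed

lemma set_integrable_imp_set_borel_measurable:
  "set_integrable M S f \<Longrightarrow> set_borel_measurable M S f"
  unfolding set_integrable_def set_borel_measurable_def by (rule borel_measurable_integrable)

lemma set_integrable_einterval_subset:
  fixes f :: "real \<Rightarrow> 'v::euclidean_space"
  assumes "set_integrable lebesgue (einterval a b) f" "a \<le> c" "d \<le> b"
  shows "set_integrable lebesgue (einterval c d) f"
  using set_integrable_subset[OF assms(1) einterval_lebesgue einterval_mono[OF assms(2,3)]] .

text \<open>A real \<open>x\<close> excludes only a null singleton and an infinite \<open>x\<close>
  excludes nothing, so open intervals can be cut at any extended real without affecting
  integrals.\<close>

lemma AE_lebesgue_neq: "AE y in lebesgue. ereal y \<noteq> x"
proof (cases x)
  case (real r)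
  have "negligible {r}" by simp
  then have "{r} \<in> null_sets lebesgue" by (simp add: negligible_iff_null_sets)
  from AE_not_in[OF this] show ?thesis using real by simp
qed auto

lemma set_integral_einterval_combine:
  fixes f :: "real \<Rightarrow> 'v::euclidean_space"
  assumes "set_integrable lebesgue (einterval a c) f" "a \<le> b" "b \<le> c"
  shows "(LINT y:einterval a c|lebesgue. f y)
    = (LINT y:einterval a b|lebesgue. f y) + (LINT y:einterval b c|lebesgue. f y)"
proof -
  have i1: "set_integrable lebesgue (einterval a b) f" and i2: "set_integrable lebesgue (einterval b c) f"
    using set_integrable_einterval_subset[OF assms(1)] assms by auto
  have "(LINT y:einterval a c|lebesgue. f y) = (LINT y:einterval a b \<union> einterval b c|lebesgue. f y)"
  proof (rule set_integral_cong_set)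
    show "set_borel_measurable lebesgue (einterval a c) f"
      using assms(1) by (rule set_integrable_imp_set_borel_measurable)
    show "set_borel_measurable lebesgue (einterval a b \<union> einterval b c) f"
      using set_integrable_Un[OF i1 i2] by (intro set_integrable_imp_set_borel_measurable) simp
    show "AE x in lebesgue. (x \<in> einterval a b \<union> einterval b c) = (x \<in> einterval a c)"
      using AE_lebesgue_neq[of b]
    proof eventually_elim
      case (elim x)
      then show ?case using assms(2,3) by (auto simp: einterval_iff)
    qed
  qed
  also have "\<dots> = (LINT y:einterval a b|lebesgue. f y) + (LINT y:einterval b c|lebesgue. f y)"
    by (rule set_integral_Un[OF _ i1 i2]) (auto simp: einterval_iff)
  finally show ?thesis .
qed

lemma set_integral_Icc_eq_Ioo:
  fixes f :: "real \<Rightarrow> 'v::euclidean_space"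
  assumes "set_integrable lebesgue {c..d} f"
  shows "(LINT t:{c..d}|lebesgue. f t) = (LINT t:{c<..<d}|lebesgue. f t)"
proof (rule set_integral_cong_set)
  show "set_borel_measurable lebesgue {c..d} f"
    using assms by (rule set_integrable_imp_set_borel_measurable)
  have "set_integrable lebesgue {c<..<d} f"
    by (rule set_integrable_subset[OF assms]) auto
  then show "set_borel_measurable lebesgue {c<..<d} f"
    by (rule set_integrable_imp_set_borel_measurable)
  show "AE t in lebesgue. (t \<in> {c<..<d}) = (t \<in> {c..d})"
    using AE_lebesgue_neq[of "ereal c"] AE_lebesgue_neq[of "ereal d"] by eventually_elim auto
qed

text \<open>The affine substitution with factor -1 and offset 0. It turns statements anchored at the
  left endpoint into statements anchored at the right one.\<close>

lemma set_integral_reflect_einterval: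
  fixes f :: "real \<Rightarrow> 'v::euclidean_space"
  shows "set_integrable lebesgue (einterval (-b) (-a)) (\<lambda>t. f (-t)) \<longleftrightarrow> set_integrable lebesgue (einterval a b) f"
    and "(LINT t:einterval (-b) (-a)|lebesgue. f (-t)) = (LINT t:einterval a b|lebesgue. f t)"
proof -
  have eq: "indicat_real (einterval (-b) (-a)) t *\<^sub>R f (-t) = (\<lambda>s. indicat_real (einterval a b) s *\<^sub>R f s) (0 + (-1) * t)" for t
    by (cases a; cases b) (auto simp: indicator_def einterval_def)
  show "set_integrable lebesgue (einterval (-b) (-a)) (\<lambda>t. f (-t)) \<longleftrightarrow> set_integrable lebesgue (einterval a b) f"
    unfolding set_integrable_def eq by (rule lebesgue_integrable_real_affine_iff) simp
  show "(LINT t:einterval (-b) (-a)|lebesgue. f (-t)) = (LINT t:einterval a b|lebesgue. f t)"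
    unfolding set_lebesgue_integral_def eq
    using lebesgue_integral_real_affine[of "-1" "\<lambda>s. indicat_real (einterval a b) s *\<^sub>R f s" 0] by simp
qed

text \<open>Prepares the evaluation of kernels given piecewise below and above the diagonal. The
  integrands agree pointwise: the value 0 at \<open>y = x\<close> matches the fact that both open
  intervals omit \<open>x\<close>.\<close>

lemma set_integral_split_at:
  fixes p q :: "real \<Rightarrow> 'v::euclidean_space"
  assumes p: "set_integrable lebesgue (einterval a b) p" and q: "set_integrable lebesgue (einterval a b) q"
    and x: "x \<in> einterval a b"
  shows "(LINT y:einterval a b|lebesgue. if y < x then p y else if x < y then q y else 0)
    = (LINT y:einterval a x|lebesgue. p y) + (LINT y:einterval x b|lebesgue. q y)"
proof -
  have p': "set_integrable lebesgue (einterval a x) p" and q': "set_integrable lebesgue (einterval x b) q"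
    using x by (auto intro!: set_integrable_einterval_subset[OF p] set_integrable_einterval_subset[OF q] simp: einterval_iff less_imp_le)
  have "(indicator (einterval a b) y *\<^sub>R (if y < x then p y else if x < y then q y else 0))
     = indicator (einterval a x) y *\<^sub>R p y + indicator (einterval x b) y *\<^sub>R q y" for y
  proof -
    have "y < x \<Longrightarrow> ereal y < b" "x < y \<Longrightarrow> a < ereal y"
      using x by (auto simp: einterval_iff intro: less_trans[of _ "ereal x"])
    then show ?thesis by (auto simp: indicator_def einterval_iff)
  qed
  then show ?thesis
    using p' q' unfolding set_lebesgue_integral_def set_integrable_def by simp
qed

text \<open>Dominated convergence along sequences of extended reals: for every real \<open>y\<close>
  other than the limit \<open>x\<close>, the indicators of the intervals up to \<open>u n\<close>
  are eventually constant at \<open>y\<close>. Infinite endpoints are included, which later makes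
  the compactness of \<open>{a..b}\<close> available.\<close>

lemma continuous_on_set_integral_einterval:
  fixes f :: "real \<Rightarrow> 'v::euclidean_space"
  assumes f: "set_integrable lebesgue (einterval a b) f"
  shows "continuous_on {a..b} (\<lambda>x. LINT y:einterval a x|lebesgue. f y)"
proof (rule continuous_on_sequentiallyI)
  fix u :: "nat \<Rightarrow> ereal" and x
  assume u: "\<forall>n. u n \<in> {a..b}" and x: "x \<in> {a..b}" and lim: "u \<longlonglongrightarrow> x"
  have meas: "(\<lambda>y. indicator (einterval a t) y *\<^sub>R f y) \<in> borel_measurable lebesgue" if "t \<in> {a..b}" for t
    using set_integrable_einterval_subset[OF f, of a t] that unfolding set_integrable_def by auto
  show "(\<lambda>n. LINT y:einterval a (u n)|lebesgue. f y) \<longlonglongrightarrow> (LINT y:einterval a x|lebesgue. f y)"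
    unfolding set_lebesgue_integral_def
  proof (rule integral_dominated_convergence[where w="\<lambda>y. norm (indicator (einterval a b) y *\<^sub>R f y)"])
    show "integrable lebesgue (\<lambda>y. norm (indicator (einterval a b) y *\<^sub>R f y))"
      using f unfolding set_integrable_def by (rule integrable_norm)
    show "AE y in lebesgue. (\<lambda>i. indicator (einterval a (u i)) y *\<^sub>R f y) \<longlonglongrightarrow> indicator (einterval a x) y *\<^sub>R f y"
      using AE_lebesgue_neq[of x]
    proof eventually_elim
      case (elim y)
      have "\<forall>\<^sub>F i in sequentially. (ereal y < u i) = (ereal y < x)"
      proof (cases "ereal y < x")
        case True
        then show ?thesis using order_tendstoD(1)[OF lim True] by simp
      next
        case False
        then have "x < ereal y" using elim by auto
        from order_tendstoD(2)[OF lim this] show ?thesis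
          by eventually_elim (use False in auto)
      qed
      then have "\<forall>\<^sub>F i in sequentially. indicator (einterval a (u i)) y *\<^sub>R f y = indicator (einterval a x) y *\<^sub>R f y"
        by eventually_elim (auto simp: einterval_iff indicator_def)
      then show ?case by (rule tendsto_eventually)
    qed
    show "AE y in lebesgue. norm (indicator (einterval a (u i)) y *\<^sub>R f y) \<le> norm (indicator (einterval a b) y *\<^sub>R f y)" for i
      using u[rule_format, of i] by (intro AE_I2) (auto simp: einterval_iff indicator_def)
  qed (use meas u x in auto)
qed

text \<open>Carries identities that are obtained by differentiation, hence only at interior real
  points, to the possibly infinite endpoints.\<close>

lemma continuous_on_ereal_const_closure:
  fixes F :: "ereal \<Rightarrow> 'v::real_normed_vector"
  assumes "a < b" "continuous_on {a..b} F" and "\<And>x. x \<in> einterval a b \<Longrightarrow> F (ereal x) = c" and "e \<in> {a..b}"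
  shows "F e = c"
proof -
  have cl: "closure {a<..<b} = {a..b}" using \<open>a < b\<close> by (rule closure_greaterThanLessThan)
  show ?thesis
  proof (rule continuous_constant_on_closure[of "{a<..<b}" F c e])
    show "F x = c" if "x \<in> {a<..<b}" for x
    proof (cases x)
      case (real r)
      then show ?thesis using that assms(3)[of r] by (simp add: einterval_iff)
    qed (use that in auto)
  qed (use assms cl in auto)
qed

lemma set_integral_bounded_linear:
  fixes f :: "'a \<Rightarrow> 'v::{banach, second_countable_topology}"
    and T :: "'v \<Rightarrow> 'w::{banach, second_countable_topology}"
  assumes "bounded_linear T" "set_integrable M S f"
  shows "set_integrable M S (\<lambda>x. T (f x))" "(LINT x:S|M. T (f x)) = T (LINT x:S|M. f x)"
proof -
  have eq: "indicator S x *\<^sub>R T (f x) = T (indicator S x *\<^sub>R f x)" for x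
    by (simp add: linear_cmul[OF bounded_linear.linear[OF assms(1)]])
  show "set_integrable M S (\<lambda>x. T (f x))" "(LINT x:S|M. T (f x)) = T (LINT x:S|M. f x)"
    using assms(2) unfolding set_integrable_def set_lebesgue_integral_def eq
    by (auto intro: integrable_bounded_linear integral_bounded_linear assms(1))
qed

lemma set_borel_measurable_continuous_on:
  fixes f :: "real \<Rightarrow> 'v::euclidean_space"
  assumes "J \<in> sets borel" "continuous_on J f"
  shows "set_borel_measurable lebesgue J f"
proof -
  have "(\<lambda>x. indicator J x *\<^sub>R f x) \<in> borel_measurable borel"
    using assms by (rule borel_measurable_continuous_on_indicator)
  then show ?thesis
    unfolding set_borel_measurable_def by (intro measurable_completion) simp
qed

text \<open>Absolute continuity of the integral: truncating \<open>norm f\<close> at a height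
  \<open>n\<close> leaves an excess of integral below \<epsilon>/2, and the truncated part
  contributes at most \<open>n\<close> times the measure of \<open>S\<close>.\<close>

lemma set_integral_small_on_small_sets:
  fixes f :: "'a \<Rightarrow> 'v::{banach, second_countable_topology}"
  assumes f: "integrable M f" and "\<epsilon> > 0"
  shows "\<exists>\<delta>>0. \<forall>S\<in>fmeasurable M. measure M S < \<delta> \<longrightarrow> (LINT x:S|M. norm (f x)) < \<epsilon>"
proof -
  define h where "h = (\<lambda>x. norm (f x))"
  have h: "integrable M h" using f by (simp add: h_def)
  have hm[measurable]: "h \<in> borel_measurable M" using h by blast
  have h0: "h x \<ge> 0" for x by (simp add: h_def)
  have "(\<lambda>n. \<integral>x. h x - min (h x) (real n) \<partial>M) \<longlonglongrightarrow> (\<integral>x. 0 \<partial>M)"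
  proof (rule integral_dominated_convergence[where w=h])
    show "AE x in M. (\<lambda>n. h x - min (h x) (real n)) \<longlonglongrightarrow> 0"
    proof (intro AE_I2)
      fix x
      have "\<forall>\<^sub>F n in sequentially. h x - min (h x) (real n) = 0"
        using eventually_ge_at_top[of "nat \<lceil>h x\<rceil>"]
        by eventually_elim (simp add: min_def nat_ceiling_le_eq)
      then show "(\<lambda>n. h x - min (h x) (real n)) \<longlonglongrightarrow> 0" by (rule tendsto_eventually)
    qed
    show "AE x in M. norm (h x - min (h x) (real n)) \<le> h x" for n
      using h0 by (intro AE_I2) (auto simp: min_def)
  qed (use h in auto)
  then have "\<forall>\<^sub>F n in sequentially. (\<integral>x. h x - min (h x) (real n) \<partial>M) < \<epsilon>/2"
    using \<open>\<epsilon> > 0\<close> by (intro order_tendstoD) auto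
  then obtain n where n: "(\<integral>x. h x - min (h x) (real n) \<partial>M) < \<epsilon>/2"
    unfolding eventually_sequentially by blast
  have imin: "integrable M (\<lambda>x. min (h x) (real n))"
    by (rule Bochner_Integration.integrable_bound[OF h]) (use h0 in \<open>auto intro!: AE_I2 simp: min_def\<close>)
  \<comment> \<open>Leaves \<epsilon>/2 for the truncated part; \<open>n + 1\<close> replaces
    \<open>n\<close>, which may be 0.\<close>
  define \<delta> where "\<delta> = \<epsilon> / (2 * (real n + 1))"
  have "\<delta> > 0" using \<open>\<epsilon> > 0\<close> by (simp add: \<delta>_def)
  moreover have "(LINT x:S|M. norm (f x)) < \<epsilon>" if S: "S \<in> fmeasurable M" "measure M S < \<delta>" for S
  proof -
    have Ssets: "S \<in> sets M" using S by auto
    have iS: "integrable M (indicat_real S)"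
      using S by (simp add: fmeasurable_def)
    have "(LINT x:S|M. norm (f x)) \<le> (\<integral>x. (h x - min (h x) (real n)) + real n * indicator S x \<partial>M)"
      unfolding set_lebesgue_integral_def
    proof (rule integral_mono)
      show "integrable M (\<lambda>x. indicator S x *\<^sub>R norm (f x))"
        using integrable_mult_indicator[OF Ssets h] by (simp add: h_def)
      show "integrable M (\<lambda>x. (h x - min (h x) (real n)) + real n * indicator S x)"
        using h imin iS by auto
      show "indicator S x *\<^sub>R norm (f x) \<le> (h x - min (h x) (real n)) + real n * indicator S x" for x
        by (auto simp: indicator_def h_def min_def)
    qed
    also have "\<dots> = (\<integral>x. h x - min (h x) (real n) \<partial>M) + real n * measure M S"
      using h imin iS Ssets S by (simp add: Int_absorb1 sets.sets_into_space)
    also have "\<dots> < \<epsilon>/2 + \<epsilon>/2"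
    proof -
      have "real n * measure M S \<le> (real n + 1) * \<delta>"
        using S by (intro mult_mono) auto
      also have "\<dots> = \<epsilon>/2" by (simp add: \<delta>_def field_simps)
      finally show ?thesis using n by simp
    qed
    finally show ?thesis by simp
  qed
  ultimately show ?thesis by blast
qed

lemma negligible_uminus_image:
  fixes N :: "'a::euclidean_space set"
  assumes "negligible N"
  shows "negligible (uminus ` N)"
  by (rule negligible_differentiable_image_negligible[OF order_refl assms])
    (auto intro!: derivative_intros simp: differentiable_on_def)

section \<open>Absolutely continuous functions\<close>

lemma absolutely_continuous_on_interval_cong:
  assumes "\<And>x. x \<in> {c..d} \<Longrightarrow> f x = g x"
  shows "absolutely_continuous_on_interval c d f \<longleftrightarrow> absolutely_continuous_on_interval c d g"
proof -
  have *: "absolutely_continuous_on_interval c d g"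
    if f: "absolutely_continuous_on_interval c d f" and eq: "\<And>x. x \<in> {c..d} \<Longrightarrow> f x = g x" for f g :: "real \<Rightarrow> 'a"
    unfolding absolutely_continuous_on_interval_def
  proof (intro allI impI)
    fix \<epsilon> :: real assume \<epsilon>: "\<epsilon> > 0"
    obtain \<delta> where \<delta>: "\<delta> > 0"
      and ac: "\<forall>(N::nat) u v. (\<forall>i<N. c \<le> u i \<and> u i \<le> v i \<and> v i \<le> d) \<and>
         (\<forall>i<N. \<forall>j<N. i \<noteq> j \<longrightarrow> {u i<..<v i} \<inter> {u j<..<v j} = {}) \<and>
         (\<Sum>i<N. v i - u i) < \<delta> \<longrightarrow> (\<Sum>i<N. norm (f (v i) - f (u i))) < \<epsilon>"
      using f[unfolded absolutely_continuous_on_interval_def, THEN spec, THEN mp, OF \<epsilon>] by (elim exE conjE)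
    show "\<exists>\<delta>>0. \<forall>(N::nat) u v.
       (\<forall>i<N. c \<le> u i \<and> u i \<le> v i \<and> v i \<le> d) \<and>
       (\<forall>i<N. \<forall>j<N. i \<noteq> j \<longrightarrow> {u i<..<v i} \<inter> {u j<..<v j} = {}) \<and>
       (\<Sum>i<N. v i - u i) < \<delta> \<longrightarrow> (\<Sum>i<N. norm (g (v i) - g (u i))) < \<epsilon>"
    proof (intro exI[of _ \<delta>] conjI \<delta> allI impI; elim conjE)
      fix N :: nat and u v
      assume uv: "\<forall>i<N. c \<le> u i \<and> u i \<le> v i \<and> v i \<le> d"
        and disj: "\<forall>i<N. \<forall>j<N. i \<noteq> j \<longrightarrow> {u i<..<v i} \<inter> {u j<..<v j} = {}"
        and len: "(\<Sum>i<N. v i - u i) < \<delta>"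
      have "(\<Sum>i<N. norm (f (v i) - f (u i))) < \<epsilon>"
        by (rule ac[THEN spec, THEN spec, THEN spec, THEN mp]) (use uv disj len in \<open>intro conjI; simp\<close>)
      moreover have "f (v i) = g (v i)" "f (u i) = g (u i)" if "i < N" for i
        using uv that by (force intro: eq)+
      ultimately show "(\<Sum>i<N. norm (g (v i) - g (u i))) < \<epsilon>" by simp
    qed
  qed
  show ?thesis using *[of f g] *[of g f] assms by metis
qed

text \<open>Absolute continuity for families consisting of a single interval, \<open>N = 1\<close>,
  is uniform continuity.\<close>

lemma absolutely_continuous_on_interval_imp_continuous_on:
  fixes f :: "real \<Rightarrow> 'v::real_normed_vector"
  assumes "absolutely_continuous_on_interval c d f"
  shows "continuous_on {c..d} f"
  unfolding continuous_on_iff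
proof (intro ballI allI impI)
  fix x \<epsilon> :: real assume x: "x \<in> {c..d}" and \<epsilon>: "\<epsilon> > 0"
  obtain \<delta> where \<delta>: "\<delta> > 0"
    and ac: "\<forall>(N::nat) u v. (\<forall>i<N. c \<le> u i \<and> u i \<le> v i \<and> v i \<le> d) \<and>
       (\<forall>i<N. \<forall>j<N. i \<noteq> j \<longrightarrow> {u i<..<v i} \<inter> {u j<..<v j} = {}) \<and>
       (\<Sum>i<N. v i - u i) < \<delta> \<longrightarrow> (\<Sum>i<N. norm (f (v i) - f (u i))) < \<epsilon>"
    using assms[unfolded absolutely_continuous_on_interval_def, THEN spec, THEN mp, OF \<epsilon>] by (elim exE conjE)
  have *: "norm (f t - f s) < \<epsilon>" if "c \<le> s" "s \<le> t" "t \<le> d" "t - s < \<delta>" for s t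
    using ac[THEN spec, THEN spec, THEN spec, THEN mp, of 1 "\<lambda>_. s" "\<lambda>_. t"] that by simp
  show "\<exists>\<delta>>0. \<forall>x'\<in>{c..d}. dist x' x < \<delta> \<longrightarrow> dist (f x') (f x) < \<epsilon>"
  proof (intro exI[of _ \<delta>] conjI ballI impI \<delta>)
    fix y assume y: "y \<in> {c..d}" "dist y x < \<delta>"
    show "dist (f y) (f x) < \<epsilon>"
    proof (cases "x \<le> y")
      case True
      then show ?thesis using *[of x y] x y by (simp add: dist_norm)
    next
      case False
      then show ?thesis using *[of y x] x y by (simp add: dist_norm norm_minus_commute)
    qed
  qed
qed

text \<open>Covers matrix products and matrix-vector products at once. The increment of a product
  telescopes into one increment of \<open>f\<close> and one of \<open>g\<close>, and the remaining
  factor is bounded, being continuous on a compact interval.\<close>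

lemma absolutely_continuous_on_interval_bilinear:
  fixes f :: "real \<Rightarrow> 'u::real_normed_vector" and g :: "real \<Rightarrow> 'v::real_normed_vector"
    and pr :: "'u \<Rightarrow> 'v \<Rightarrow> 'w::real_normed_vector"
  assumes b: "bounded_bilinear pr"
    and f: "absolutely_continuous_on_interval c d f" and g: "absolutely_continuous_on_interval c d g"
  shows "absolutely_continuous_on_interval c d (\<lambda>x. pr (f x) (g x))"
  unfolding absolutely_continuous_on_interval_def
proof (intro allI impI)
  interpret bounded_bilinear pr by fact
  fix \<epsilon> :: real assume \<epsilon>: "\<epsilon> > 0"
  obtain K where K: "K > 0" "\<And>u v. norm (pr u v) \<le> norm u * norm v * K"
    using pos_bounded by blast
  have "bounded (f ` {c..d})" "bounded (g ` {c..d})"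
    using compact_continuous_image[OF absolutely_continuous_on_interval_imp_continuous_on] f g
    by (auto intro: compact_imp_bounded)
  then obtain Mf Mg where M: "Mf > 0" "\<And>x. x \<in> {c..d} \<Longrightarrow> norm (f x) \<le> Mf"
     "Mg > 0" "\<And>x. x \<in> {c..d} \<Longrightarrow> norm (g x) \<le> Mg"
    by (auto simp: bounded_pos)
  \<comment> \<open>Each of the two telescoped sums may contribute \<epsilon>/2; the bound for the
    other factor and the constant \<open>K\<close> of the bilinear map are divided out.\<close>
  define ef where "ef = \<epsilon> / (2 * Mg * K)"
  define eg where "eg = \<epsilon> / (2 * Mf * K)"
  have e: "ef > 0" "eg > 0" using \<epsilon> M K by (auto simp: ef_def eg_def)
  obtain \<delta>f where \<delta>f: "\<delta>f > 0"
    and acf: "\<forall>(N::nat) u v. (\<forall>i<N. c \<le> u i \<and> u i \<le> v i \<and> v i \<le> d) \<and>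
       (\<forall>i<N. \<forall>j<N. i \<noteq> j \<longrightarrow> {u i<..<v i} \<inter> {u j<..<v j} = {}) \<and>
       (\<Sum>i<N. v i - u i) < \<delta>f \<longrightarrow> (\<Sum>i<N. norm (f (v i) - f (u i))) < ef"
    using f[unfolded absolutely_continuous_on_interval_def, THEN spec, THEN mp, OF e(1)] by (elim exE conjE)
  obtain \<delta>g where \<delta>g: "\<delta>g > 0"
    and acg: "\<forall>(N::nat) u v. (\<forall>i<N. c \<le> u i \<and> u i \<le> v i \<and> v i \<le> d) \<and>
       (\<forall>i<N. \<forall>j<N. i \<noteq> j \<longrightarrow> {u i<..<v i} \<inter> {u j<..<v j} = {}) \<and>
       (\<Sum>i<N. v i - u i) < \<delta>g \<longrightarrow> (\<Sum>i<N. norm (g (v i) - g (u i))) < eg"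
    using g[unfolded absolutely_continuous_on_interval_def, THEN spec, THEN mp, OF e(2)] by (elim exE conjE)
  show "\<exists>\<delta>>0. \<forall>(N::nat) u v.
       (\<forall>i<N. c \<le> u i \<and> u i \<le> v i \<and> v i \<le> d) \<and>
       (\<forall>i<N. \<forall>j<N. i \<noteq> j \<longrightarrow> {u i<..<v i} \<inter> {u j<..<v j} = {}) \<and>
       (\<Sum>i<N. v i - u i) < \<delta>
       \<longrightarrow> (\<Sum>i<N. norm (pr (f (v i)) (g (v i)) - pr (f (u i)) (g (u i)))) < \<epsilon>"
  proof (intro exI[of _ "min \<delta>f \<delta>g"] conjI allI impI; (elim conjE)?)
    fix N :: nat and u v
    assume uv: "\<forall>i<N. c \<le> u i \<and> u i \<le> v i \<and> v i \<le> d"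
      and disj: "\<forall>i<N. \<forall>j<N. i \<noteq> j \<longrightarrow> {u i<..<v i} \<inter> {u j<..<v j} = {}"
      and len: "(\<Sum>i<N. v i - u i) < min \<delta>f \<delta>g"
    have sf: "(\<Sum>i<N. norm (f (v i) - f (u i))) < ef"
      by (rule acf[THEN spec, THEN spec, THEN spec, THEN mp]) (use uv disj len in \<open>intro conjI; simp\<close>)
    have sg: "(\<Sum>i<N. norm (g (v i) - g (u i))) < eg"
      by (rule acg[THEN spec, THEN spec, THEN spec, THEN mp]) (use uv disj len in \<open>intro conjI; simp\<close>)
    have "norm (pr (f (v i)) (g (v i)) - pr (f (u i)) (g (u i)))
      \<le> Mg * K * norm (f (v i) - f (u i)) + Mf * K * norm (g (v i) - g (u i))" if "i < N" for i
    proof -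
      have mem: "u i \<in> {c..d}" "v i \<in> {c..d}" using uv that by force+
      have "pr (f (v i)) (g (v i)) - pr (f (u i)) (g (u i))
        = pr (f (v i) - f (u i)) (g (v i)) + pr (f (u i)) (g (v i) - g (u i))"
        by (simp add: diff_left diff_right)
      also have "norm \<dots> \<le> norm (f (v i) - f (u i)) * norm (g (v i)) * K + norm (f (u i)) * norm (g (v i) - g (u i)) * K"
        by (intro norm_triangle_le add_mono K)
      also have "\<dots> \<le> norm (f (v i) - f (u i)) * Mg * K + Mf * norm (g (v i) - g (u i)) * K"
        using M K mem by (intro add_mono mult_right_mono mult_left_mono) auto
      finally show ?thesis by (simp add: mult_ac)
    qed
    then have "(\<Sum>i<N. norm (pr (f (v i)) (g (v i)) - pr (f (u i)) (g (u i))))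
       \<le> (\<Sum>i<N. Mg * K * norm (f (v i) - f (u i)) + Mf * K * norm (g (v i) - g (u i)))"
      by (intro sum_mono) simp
    also have "\<dots> = Mg * K * (\<Sum>i<N. norm (f (v i) - f (u i))) + Mf * K * (\<Sum>i<N. norm (g (v i) - g (u i)))"
      by (simp add: sum.distrib sum_distrib_left)
    also have "\<dots> < Mg * K * ef + Mf * K * eg"
      using sf sg M(1,3) K(1) by (intro add_strict_mono mult_strict_left_mono) simp_all
    also have "\<dots> = \<epsilon>" using M(1,3) K(1) by (simp add: ef_def eg_def)
    finally show "(\<Sum>i<N. norm (pr (f (v i)) (g (v i)) - pr (f (u i)) (g (u i)))) < \<epsilon>" .
  qed (use \<delta>f \<delta>g in auto)
qed

text \<open>The increments are bounded by the integral of \<open>norm f\<close> over the disjoint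
  union of the intervals. The measure of that union is the total length, so absolute continuity of
  the integral applies.\<close>

lemma absolutely_continuous_on_interval_integral:
  fixes f F :: "real \<Rightarrow> 'v::euclidean_space"
  assumes f: "set_integrable lebesgue {c..d} f"
    and F: "\<And>x y. c \<le> x \<Longrightarrow> x \<le> y \<Longrightarrow> y \<le> d \<Longrightarrow> F y - F x = (LINT t:{x<..<y}|lebesgue. f t)"
  shows "absolutely_continuous_on_interval c d F"
  unfolding absolutely_continuous_on_interval_def
proof (intro allI impI)
  fix \<epsilon> :: real assume "\<epsilon> > 0"
  define f0 where "f0 = (\<lambda>t. indicator {c..d} t *\<^sub>R f t)"
  have f0: "integrable lebesgue f0" using f by (simp add: f0_def set_integrable_def)
  from set_integral_small_on_small_sets[OF f0 \<open>\<epsilon> > 0\<close>] obtain \<delta> where \<delta>: "\<delta> > 0"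
    "\<And>S. S \<in> lmeasurable \<Longrightarrow> measure lebesgue S < \<delta> \<Longrightarrow> (LINT x:S|lebesgue. norm (f0 x)) < \<epsilon>" by blast
  show "\<exists>\<delta>>0. \<forall>(N::nat) u v.
       (\<forall>i<N. c \<le> u i \<and> u i \<le> v i \<and> v i \<le> d) \<and>
       (\<forall>i<N. \<forall>j<N. i \<noteq> j \<longrightarrow> {u i<..<v i} \<inter> {u j<..<v j} = {}) \<and>
       (\<Sum>i<N. v i - u i) < \<delta>
       \<longrightarrow> (\<Sum>i<N. norm (F (v i) - F (u i))) < \<epsilon>"
  proof (intro exI conjI allI impI; (elim conjE)?)
    fix N :: nat and u v :: "nat \<Rightarrow> real"
    assume uv: "\<forall>i<N. c \<le> u i \<and> u i \<le> v i \<and> v i \<le> d"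
      and disj: "\<forall>i<N. \<forall>j<N. i \<noteq> j \<longrightarrow> {u i<..<v i} \<inter> {u j<..<v j} = {}"
      and len: "(\<Sum>i<N. v i - u i) < \<delta>"
    define S where "S = (\<Union>i<N. {u i<..<v i})"
    have df: "disjoint_family_on (\<lambda>i. {u i<..<v i}) {..<N}"
      using disj by (simp add: disjoint_family_on_def)
    have "measure lebesgue S = (\<Sum>i<N. measure lebesgue {u i<..<v i})"
      unfolding S_def by (rule measure_finite_Union) (use df uv in auto)
    also have "\<dots> = (\<Sum>i<N. v i - u i)" using uv by (intro sum.cong) auto
    finally have "measure lebesgue S < \<delta>" using len by simp
    moreover have "S \<in> lmeasurable" unfolding S_def by (intro fmeasurable.finite_UN) auto
    ultimately have "(LINT x:S|lebesgue. norm (f0 x)) < \<epsilon>" using \<delta> by blast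
    moreover have "(LINT x:S|lebesgue. norm (f0 x)) = (\<Sum>i<N. LINT x:{u i<..<v i}|lebesgue. norm (f0 x))"
      unfolding S_def
    proof (rule set_integral_finite_Union)
      show "set_integrable lebesgue {u i<..<v i} (\<lambda>x. norm (f0 x))" if "i \<in> {..<N}" for i
        unfolding set_integrable_def by (rule integrable_mult_indicator) (use f0 in auto)
    qed (use df in auto)
    moreover have "norm (F (v i) - F (u i)) \<le> (LINT x:{u i<..<v i}|lebesgue. norm (f0 x))" if "i < N" for i
    proof -
      have sub: "{u i<..<v i} \<subseteq> {c..d}" using uv that by fastforce
      have "F (v i) - F (u i) = (LINT t:{u i<..<v i}|lebesgue. f t)" using uv that by (intro F) auto
      also have "norm \<dots> \<le> (LINT t:{u i<..<v i}|lebesgue. norm (f t))"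
        by (rule set_integral_norm_bound, rule set_integrable_subset[OF f]) (use sub in auto)
      also have "\<dots> = (LINT x:{u i<..<v i}|lebesgue. norm (f0 x))"
        by (rule set_lebesgue_integral_cong) (use sub in \<open>auto simp: f0_def indicator_def\<close>)
      finally show ?thesis .
    qed
    ultimately show "(\<Sum>i<N. norm (F (v i) - F (u i))) < \<epsilon>"
      using sum_mono[of "{..<N}" "\<lambda>i. norm (F (v i) - F (u i))" "\<lambda>i. LINT x:{u i<..<v i}|lebesgue. norm (f0 x)"]
      by auto
  qed (use \<delta> in auto)
qed

text \<open>
  The library's differentiation theorem only concerns the difference quotients over \<open>[x, x + h]\<close>;
  those over \<open>[x - h, x]\<close> are obtained by applying it to the reflected function.
\<close>

lemma AE_has_vector_derivative_integral:
  fixes f F :: "real \<Rightarrow> 'v::euclidean_space"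
  assumes J: "open J" and f: "set_integrable lebesgue J f"
    and F: "\<And>x y. x \<le> y \<Longrightarrow> {x..y} \<subseteq> J \<Longrightarrow> F y - F x = (LINT t:{x<..<y}|lebesgue. f t)"
  shows "AE x\<in>J in lebesgue. (F has_vector_derivative f x) (at x)"
proof -
  \<comment> \<open>Extension by zero gives a function integrable over every compact interval; near
    a point of the open set \<open>J\<close> its averages are difference quotients of
    \<open>F\<close>.\<close>
  define f0 where "f0 = (\<lambda>t. indicator J t *\<^sub>R f t)"
  have f0: "integrable lebesgue f0" using f by (simp add: f0_def set_integrable_def)
  have si: "set_integrable lebesgue {x..y} f0" for x y
    unfolding set_integrable_def by (rule integrable_mult_indicator) (use f0 in auto)
  have ion: "f0 integrable_on {x..y}" for x y
    using set_lebesgue_integral_eq_integral(1)[OF si] .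
  have FI: "integral {x..y} f0 = F y - F x" if "x \<le> y" "{x..y} \<subseteq> J" for x y
  proof -
    have "integral {x..y} f0 = (LINT t:{x..y}|lebesgue. f0 t)"
      using set_lebesgue_integral_eq_integral(2)[OF si] by simp
    also have "\<dots> = (LINT t:{x<..<y}|lebesgue. f0 t)" by (rule set_integral_Icc_eq_Ioo[OF si])
    also have "\<dots> = (LINT t:{x<..<y}|lebesgue. f t)"
    proof -
      have "{x<..<y} \<subseteq> J" using that by fastforce
      then show ?thesis by (intro set_lebesgue_integral_cong) (auto simp: f0_def)
    qed
    finally show ?thesis using F[OF that] by simp
  qed
  obtain N1 where N1: "negligible N1"
    "\<And>x e. \<lbrakk>x \<notin> N1; 0 < e\<rbrakk> \<Longrightarrow> \<exists>d>0. \<forall>h. 0 < h \<and> h < d \<longrightarrow> norm (integral {x..x+h} f0 /\<^sub>R h - f0 x) < e"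
    using integrable_ccontinuous_explicit[of f0] ion by (auto simp: DIM_real)
  obtain N2 where N2: "negligible N2"
    "\<And>x e. \<lbrakk>x \<notin> N2; 0 < e\<rbrakk> \<Longrightarrow> \<exists>d>0. \<forall>h. 0 < h \<and> h < d \<longrightarrow> norm (integral {x..x+h} (\<lambda>t. f0 (-t)) /\<^sub>R h - f0 (-x)) < e"
  proof -
    have "(\<lambda>t. f0 (-t)) integrable_on {x..y}" for x y
      using ion[of "-y" "-x"] Henstock_Kurzweil_Integration.integrable_reflect_real[of f0 "-x" "-y"] by simp
    then show ?thesis using integrable_ccontinuous_explicit[of "\<lambda>t. f0 (-t)"] that by (auto simp: DIM_real)
  qed
  have neg: "negligible (uminus ` N2)"
    using N2(1) by (rule negligible_uminus_image)
  have ae: "AE x in lebesgue. x \<notin> N1 \<and> x \<notin> uminus ` N2"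
    using AE_not_in[of N1 lebesgue] AE_not_in[of "uminus ` N2" lebesgue] N1(1) neg
    by (auto simp: negligible_iff_null_sets)
  show ?thesis
    using ae
  proof eventually_elim
    case (elim x)
    show ?case
    proof
      assume xJ: "x \<in> J"
      have f0x: "f0 x = f x" using xJ by (simp add: f0_def)
      have x2: "- x \<notin> N2" using elim by (metis image_eqI minus_minus)
      obtain r where r: "r > 0" "cball x r \<subseteq> J" using J xJ open_contains_cball by blast
      show "(F has_vector_derivative f x) (at x)"
        unfolding has_vector_derivative_def has_derivative_at_alt
      proof (intro conjI allI impI)
        show "bounded_linear (\<lambda>t. t *\<^sub>R f x)" by (rule bounded_linear_scaleR_left)
        fix e :: real assume e: "e > 0"
        obtain d1 where d1: "d1 > 0" "\<And>h. 0 < h \<Longrightarrow> h < d1 \<Longrightarrow> norm (integral {x..x+h} f0 /\<^sub>R h - f0 x) < e"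
          using N1(2)[of x e] elim e by auto
        obtain d2 where d2: "d2 > 0" "\<And>h. 0 < h \<Longrightarrow> h < d2 \<Longrightarrow> norm (integral {-x..-x+h} (\<lambda>t. f0 (-t)) /\<^sub>R h - f0 x) < e"
          using N2(2)[of "-x" e] x2 e by auto
        \<comment> \<open>Multiplying by the step length turns the bound on averages into the
          estimate required for differentiability; it is applied with \<open>h = y - x\<close> and
          with \<open>h = x - y\<close>.\<close>
        have key: "norm (I - h *\<^sub>R f x) \<le> e * h" if "h > 0" "norm (I /\<^sub>R h - f0 x) < e" for I h
        proof -
          have "I - h *\<^sub>R f x = h *\<^sub>R (I /\<^sub>R h - f0 x)" using that by (simp add: f0x scaleR_diff_right)
          then show ?thesis using that by (simp add: mult.commute mult_left_mono less_imp_le)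
        qed
        show "\<exists>d>0. \<forall>y. norm (y - x) < d \<longrightarrow> norm (F y - F x - (y - x) *\<^sub>R f x) \<le> e * norm (y - x)"
        proof (intro exI[of _ "min r (min d1 d2)"] conjI allI impI)
          fix y assume y: "norm (y - x) < min r (min d1 d2)"
          show "norm (F y - F x - (y - x) *\<^sub>R f x) \<le> e * norm (y - x)"
          proof (cases y x rule: linorder_cases)
            case equal
            then show ?thesis by simp
          next
            case greater
            have "{x..y} \<subseteq> J" using y r greater by (auto simp: cball_def dist_real_def subset_iff)
            then have "integral {x..x + (y - x)} f0 = F y - F x" using FI[of x y] greater by simp
            then show ?thesis using key[of "y - x" "F y - F x"] d1(2)[of "y - x"] greater y by simp
          next
            case less
            have "{y..x} \<subseteq> J" using y r less by (auto simp: cball_def dist_real_def subset_iff)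
            then have "integral {y..x} f0 = F x - F y" using FI[of y x] less by simp
            then have "integral {-x..-x + (x - y)} (\<lambda>t. f0 (-t)) = F x - F y"
              using Henstock_Kurzweil_Integration.integral_reflect_real[of x y f0] by simp
            then have "norm (F x - F y - (x - y) *\<^sub>R f x) \<le> e * (x - y)"
              using key[of "x - y" "F x - F y"] d2(2)[of "x - y"] less y by simp
            moreover have "F y - F x - (y - x) *\<^sub>R f x = - (F x - F y - (x - y) *\<^sub>R f x)"
              by (simp add: algebra_simps)
            ultimately show ?thesis using less by (metis abs_of_neg diff_less_0_iff_less minus_diff_eq norm_minus_cancel real_norm_def)
          qed
        qed (use r d1 d2 in auto)
      qed
    qed
  qed
qed

text \<open>Only increments of \<open>F\<close> enter, so the lemma applies to functions such as
  \<open>U\<close> and the split primitives, which are assembled from integrals starting at both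
  endpoints.\<close>

lemma indefinite_integral_locally_absolutely_continuous:
  fixes f F :: "real \<Rightarrow> 'v::euclidean_space"
  assumes f: "set_integrable lebesgue (einterval a b) f"
    and F: "\<And>x y. x \<in> einterval a b \<Longrightarrow> y \<in> einterval a b \<Longrightarrow> x \<le> y \<Longrightarrow> F y - F x = (LINT t:einterval x y|lebesgue. f t)"
  shows "locally_absolutely_continuous_on (einterval a b) F"
    and "AE x\<in>einterval a b in lebesgue. (F has_vector_derivative f x) (at x)"
proof -
  show "locally_absolutely_continuous_on (einterval a b) F"
    unfolding locally_absolutely_continuous_on_def
  proof (intro allI impI)
    fix c d assume cd: "{c..d} \<subseteq> einterval a b"
    show "absolutely_continuous_on_interval c d F"
    proof (rule absolutely_continuous_on_interval_integral)
      show "set_integrable lebesgue {c..d} f" by (rule set_integrable_subset[OF f _ cd]) simp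
      show "F y - F x = (LINT t:{x<..<y}|lebesgue. f t)" if "c \<le> x" "x \<le> y" "y \<le> d" for x y
        using F[of x y] cd that by (simp add: subset_iff)
    qed
  qed
  show "AE x\<in>einterval a b in lebesgue. (F has_vector_derivative f x) (at x)"
  proof (rule AE_has_vector_derivative_integral[OF open_einterval f])
    show "F y - F x = (LINT t:{x<..<y}|lebesgue. f t)" if "x \<le> y" "{x..y} \<subseteq> einterval a b" for x y
      using F[of x y] that by (simp add: subset_iff)
  qed
qed

text \<open>
  Outside the exceptional null set \<open>N\<close> the gauge comes from differentiability. Tags in \<open>N\<close> are confined
  to an open set containing \<open>N\<close> that is so small that absolute continuity bounds their contribution.
\<close>

lemma has_integral_absolutely_continuous:
  fixes f F :: "real \<Rightarrow> 'v::euclidean_space"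
  assumes cd: "c \<le> d" and ac: "absolutely_continuous_on_interval c d F"
    and deriv: "AE x\<in>{c..d} in lebesgue. (F has_vector_derivative f x) (at x)"
  shows "(f has_integral (F d - F c)) {c..d}"
proof -
  define N where "N = {x. \<not> (x \<in> {c..d} \<longrightarrow> (F has_vector_derivative f x) (at x))}"
  have N: "N \<in> null_sets lebesgue"
    using deriv unfolding N_def by (subst (asm) completion.AE_iff_null_sets) simp
  \<comment> \<open>Nothing is known about \<open>f\<close> on \<open>N\<close>. With the value 0
    there, pieces tagged in \<open>N\<close> contribute nothing but increments of
    \<open>F\<close>.\<close>
  define f' where "f' = (\<lambda>x. if x \<in> N then 0 else f x)"
  have f'N: "f' x = 0" if "x \<in> N" for x using that by (simp add: f'_def)
  have der: "(F has_vector_derivative f' x) (at x)" if "x \<in> {c..d}" "x \<notin> N" for x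
    using that by (auto simp: N_def f'_def)
  have "(f' has_integral (F d - F c)) (cbox c d)"
    unfolding has_integral
  proof (intro allI impI)
    fix \<epsilon> :: real assume \<epsilon>: "\<epsilon> > 0"
    \<comment> \<open>The summand 1 keeps the denominator positive when \<open>c = d\<close> and
      makes \<open>e * (d - c)\<close> strictly smaller than \<epsilon>/2, leaving the other half
      for the tags in \<open>N\<close>.\<close>
    define e where "e = \<epsilon> / (2 * (d - c + 1))"
    have e: "e > 0" and e2: "e * (d - c) < \<epsilon> / 2" using \<epsilon> cd by (auto simp: e_def field_simps)
    obtain \<delta> where \<delta>: "\<delta> > 0"
      and raw: "\<forall>(n::nat) u v. (\<forall>i<n. c \<le> u i \<and> u i \<le> v i \<and> v i \<le> d) \<and>
       (\<forall>i<n. \<forall>j<n. i \<noteq> j \<longrightarrow> {u i<..<v i} \<inter> {u j<..<v j} = {}) \<and>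
       (\<Sum>i<n. v i - u i) < \<delta> \<longrightarrow> (\<Sum>i<n. norm (F (v i) - F (u i))) < \<epsilon>/2"
      using ac[unfolded absolutely_continuous_on_interval_def, THEN spec, THEN mp, OF half_gt_zero[OF \<epsilon>]]
      by (elim exE conjE)
    have ac': "\<And>(n::nat) u v. (\<forall>i<n. c \<le> u i \<and> u i \<le> v i \<and> v i \<le> d) \<Longrightarrow>
       (\<forall>i<n. \<forall>j<n. i \<noteq> j \<longrightarrow> {u i<..<v i} \<inter> {u j<..<v j} = {}) \<Longrightarrow>
       (\<Sum>i<n. v i - u i) < \<delta> \<Longrightarrow> (\<Sum>i<n. norm (F (v i) - F (u i))) < \<epsilon>/2"
      by (rule raw[THEN spec, THEN spec, THEN spec, THEN mp]) (intro conjI)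
    obtain G where G: "open G" "N \<subseteq> G" "G - N \<in> lmeasurable" "emeasure lebesgue (G - N) < ennreal \<delta>"
      using sets_lebesgue_outer_open[of N \<delta>] N \<delta> by auto
    have Gl: "G \<in> lmeasurable"
      using G(3) N G(2) by (metis Diff_partition negligible_iff_null_sets negligible_imp_measurable fmeasurable.Un)
    have "measure lebesgue G = measure lebesgue (G - N)"
      using N Gl by (simp add: measure_Diff_null_set)
    also have "\<dots> < \<delta>" using G(3,4) \<delta>
      by (metis emeasure_eq_measure2 ennreal_less_iff measure_nonneg)
    finally have mG: "measure lebesgue G < \<delta>" .
    have "\<forall>x. \<exists>r>0. x \<in> {c..d} - N \<longrightarrow> (\<forall>y. norm (y - x) < r \<longrightarrow> norm (F y - F x - (y - x) *\<^sub>R f' x) \<le> e * norm (y - x))"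
    proof
      fix x
      show "\<exists>r>0. x \<in> {c..d} - N \<longrightarrow> (\<forall>y. norm (y - x) < r \<longrightarrow> norm (F y - F x - (y - x) *\<^sub>R f' x) \<le> e * norm (y - x))"
      proof (cases "x \<in> {c..d} - N")
        case True
        then show ?thesis using der[of x] e unfolding has_vector_derivative_def has_derivative_at_alt by auto
      qed (auto intro: exI[of _ 1])
    qed
    then obtain r where r: "\<And>x. r x > 0"
      "\<And>x y. x \<in> {c..d} - N \<Longrightarrow> norm (y - x) < r x \<Longrightarrow> norm (F y - F x - (y - x) *\<^sub>R f' x) \<le> e * norm (y - x)"
      by metis
    define \<gamma> where "\<gamma> = (\<lambda>x. if x \<in> N then G else ball x (r x))"
    have gauge: "gauge \<gamma>" using G r by (auto simp: gauge_def \<gamma>_def)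
    have sums: "norm ((\<Sum>(x,k)\<in>D. measure lborel k *\<^sub>R f' x) - (F d - F c)) < \<epsilon>"
      if D: "D tagged_division_of cbox c d" and fine: "\<gamma> fine D" for D
    proof -
      have finD: "finite D" using D by blast
      have FD: "F d - F c = (\<Sum>(x,k)\<in>D. F (Sup k) - F (Inf k))"
        using additive_tagged_division_1[OF cd, of D F] D by (simp add: cbox_interval)
      have box: "k = {Inf k..Sup k} \<and> Inf k \<le> x \<and> x \<le> Sup k \<and> c \<le> Inf k \<and> Sup k \<le> d \<and> measure lborel k = Sup k - Inf k \<and> k \<subseteq> \<gamma> x"
        if xk: "(x,k) \<in> D" for x k
      proof -
        obtain u v where "k = cbox u v" using tagged_division_ofD(4)[OF D xk] by blast
        moreover have "x \<in> k" "k \<subseteq> cbox c d" using tagged_division_ofD(2,3)[OF D xk] by auto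
        moreover have "k \<subseteq> \<gamma> x" using fine xk by (auto simp: fine_def)
        ultimately show ?thesis by (auto simp: cbox_interval)
      qed
      define DN where "DN = {(x,k). (x,k) \<in> D \<and> x \<in> N}"
      have DN: "DN \<subseteq> D" "finite DN" using finD by (auto simp: DN_def intro: finite_subset)
      define T where "T = (\<lambda>(x,k). measure lborel k *\<^sub>R f' x - (F (Sup k) - F (Inf k)))"
      have good: "norm (T p) \<le> e * measure lborel (snd p)" if "p \<in> D - DN" for p
      proof -
        obtain x k where p: "p = (x,k)" by (cases p)
        have D': "(x,k) \<in> D" "x \<notin> N" using that p by (auto simp: DN_def)
        note b = box[OF D'(1)]
        have cq: "measure lborel k = Sup k - Inf k" "Inf k \<le> x" "x \<le> Sup k" using b by blast+
        have xcd: "x \<in> {c..d} - N" using b D' by auto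
        have kb: "k \<subseteq> ball x (r x)" using b D' by (simp add: \<gamma>_def)
        have mem: "Inf k \<in> k" "Sup k \<in> k" using b by (metis atLeastAtMost_iff order_refl order_trans)+
        have "Inf k \<in> ball x (r x)" "Sup k \<in> ball x (r x)"
          using kb mem by auto
        then have n: "norm (Inf k - x) < r x" "norm (Sup k - x) < r x"
          by (auto simp: dist_norm norm_minus_commute)
        \<comment> \<open>The tag \<open>x\<close> lies between \<open>Inf k\<close> and
          \<open>Sup k\<close>, so the errors of the linear approximation at the two ends add up to
          at most \<open>e\<close> times the length of \<open>k\<close>.\<close>
        have "T p = - ((F (Sup k) - F x - (Sup k - x) *\<^sub>R f' x) - (F (Inf k) - F x - (Inf k - x) *\<^sub>R f' x))"
          unfolding p T_def prod.case cq(1) by (simp add: algebra_simps)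
        then have "norm (T p) \<le> norm (F (Sup k) - F x - (Sup k - x) *\<^sub>R f' x) + norm (F (Inf k) - F x - (Inf k - x) *\<^sub>R f' x)"
          by (metis norm_minus_cancel norm_triangle_ineq4)
        also have "\<dots> \<le> e * norm (Sup k - x) + e * norm (Inf k - x)"
          using r(2)[OF xcd n(1)] r(2)[OF xcd n(2)] by simp
        also have "\<dots> = e * measure lborel k"
        proof -
          have "measure lborel k = norm (Sup k - x) + norm (Inf k - x)"
            unfolding cq(1) using cq(2,3) by simp
          then show ?thesis by (simp only: distrib_left)
        qed
        finally show ?thesis by (simp add: p)
      qed
      have bad: "(\<Sum>p\<in>DN. norm (T p)) < \<epsilon> / 2"
      proof -
        \<comment> \<open>Absolute continuity speaks of finite sequences of intervals, hence the
          enumeration. Distinct pieces have disjoint interiors, and fineness places all of them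
          inside \<open>G\<close>.\<close>
        obtain q where q: "bij_betw q {0..<card DN} DN" using ex_bij_betw_nat_finite[OF DN(2)] by blast
        let ?n = "card DN"
        have qD: "q i \<in> DN" if "i < ?n" for i using q that by (auto simp: bij_betw_def)
        have qDN: "(fst (q i), snd (q i)) \<in> D" "fst (q i) \<in> N" if "i < ?n" for i
          using qD[OF that] by (auto simp: DN_def split_beta)
        define u where "u = (\<lambda>i. Inf (snd (q i)))"
        define v where "v = (\<lambda>i. Sup (snd (q i)))"
        have uv: "\<forall>i<?n. c \<le> u i \<and> u i \<le> v i \<and> v i \<le> d"
          using box[OF qDN(1)] by (force simp: u_def v_def)
        have disj: "\<forall>i<?n. \<forall>j<?n. i \<noteq> j \<longrightarrow> {u i<..<v i} \<inter> {u j<..<v j} = {}"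
        proof (intro allI impI)
          fix i j assume ij: "i < ?n" "j < ?n" "i \<noteq> j"
          have "q i \<noteq> q j" using q ij by (auto simp: bij_betw_def inj_on_def)
          then have "interior (snd (q i)) \<inter> interior (snd (q j)) = {}"
            using tagged_division_ofD(5)[OF D, of "fst (q i)" "snd (q i)" "fst (q j)" "snd (q j)"] qDN ij by (auto simp: prod_eq_iff)
          moreover have "interior (snd (q i)) = {u i<..<v i}" "interior (snd (q j)) = {u j<..<v j}"
            using box[OF qDN(1)[OF ij(1)]] box[OF qDN(1)[OF ij(2)]] unfolding u_def v_def
            by (metis interior_atLeastAtMost_real)+
          ultimately show "{u i<..<v i} \<inter> {u j<..<v j} = {}" by simp
        qed
        have "(\<Sum>i<?n. v i - u i) = (\<Sum>i<?n. measure lebesgue {u i<..<v i})"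
          using uv by (intro sum.cong) auto
        also have "\<dots> = measure lebesgue (\<Union>i<?n. {u i<..<v i})"
          by (rule measure_finite_Union[symmetric]) (use uv disj in \<open>auto simp: disjoint_family_on_def\<close>)
        also have "\<dots> \<le> measure lebesgue G"
        proof (rule measure_mono_fmeasurable)
          show "(\<Union>i<?n. {u i<..<v i}) \<subseteq> G"
          proof (intro UN_least)
            fix i assume "i \<in> {..<?n}"
            then have i: "i < ?n" by simp
            have "{u i<..<v i} \<subseteq> {u i..v i}" by auto
            also have "{u i..v i} = snd (q i)" using box[OF qDN(1)[OF i]] unfolding u_def v_def by blast
            also have "\<dots> \<subseteq> \<gamma> (fst (q i))" using box[OF qDN(1)[OF i]] by blast
            also have "\<dots> = G" using qDN(2)[OF i] by (simp add: \<gamma>_def)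
            finally show "{u i<..<v i} \<subseteq> G" .
          qed
        qed (use Gl in auto)
        finally have "(\<Sum>i<?n. norm (F (v i) - F (u i))) < \<epsilon>/2"
          using ac'[OF uv disj] mG by simp
        moreover have "(\<Sum>p\<in>DN. norm (T p)) = (\<Sum>i<?n. norm (T (q i)))"
          using sum.reindex_bij_betw[OF q, of "\<lambda>p. norm (T p)"] by (simp add: lessThan_atLeast0)
        moreover have "norm (T (q i)) = norm (F (v i) - F (u i))" if "i < ?n" for i
          using f'N[OF qDN(2)[OF that]] by (simp add: T_def u_def v_def split_beta norm_minus_commute)
        ultimately show ?thesis by simp
      qed
      have "(\<Sum>(x,k)\<in>D. measure lborel k *\<^sub>R f' x) - (F d - F c) = (\<Sum>p\<in>D. T p)"
        unfolding FD by (simp add: T_def sum_subtractf split_beta)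
      also have "norm \<dots> \<le> (\<Sum>p\<in>D. norm (T p))" by (rule norm_sum)
      also have "\<dots> = (\<Sum>p\<in>D - DN. norm (T p)) + (\<Sum>p\<in>DN. norm (T p))"
        using DN finD by (simp add: sum.subset_diff)
      also have "(\<Sum>p\<in>D - DN. norm (T p)) \<le> (\<Sum>p\<in>D - DN. e * measure lborel (snd p))"
        by (intro sum_mono good)
      also have "\<dots> \<le> (\<Sum>p\<in>D. e * measure lborel (snd p))"
        by (intro sum_mono2) (use finD e in auto)
      also have "\<dots> = e * (\<Sum>(x,k)\<in>D. measure lborel k)" by (simp add: sum_distrib_left split_beta)
      also have "\<dots> = e * (d - c)" using additive_content_tagged_division[OF D] cd by simp
      finally show ?thesis using bad e2 by simp
    qed
    show "\<exists>\<gamma>. gauge \<gamma> \<and> (\<forall>D. D tagged_division_of cbox c d \<and> \<gamma> fine D \<longrightarrow>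
        norm ((\<Sum>(x,k)\<in>D. measure lborel k *\<^sub>R f' x) - (F d - F c)) < \<epsilon>)"
      by (intro exI[of _ \<gamma>] conjI allI impI gauge, elim conjE, rule sums)
  qed
  then have "(f' has_integral (F d - F c)) {c..d}" by simp
  moreover have "negligible N" using N by (simp add: negligible_iff_null_sets)
  ultimately show ?thesis
    using has_integral_spike[of N "{c..d}" f f'] by (auto simp: f'_def)
qed

text \<open>The gauge integral of the derivative exists by absolute continuity; integrability of
  \<open>f\<close> identifies it with the Lebesgue integral.\<close>

lemma set_integral_absolutely_continuous:
  fixes f F :: "real \<Rightarrow> 'v::euclidean_space"
  assumes cd: "c \<le> d" and ac: "absolutely_continuous_on_interval c d F"
    and deriv: "AE x\<in>{c..d} in lebesgue. (F has_vector_derivative f x) (at x)"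
    and f: "set_integrable lebesgue {c..d} f"
  shows "(LINT t:{c<..<d}|lebesgue. f t) = F d - F c"
  using has_integral_absolutely_continuous[OF cd ac deriv] set_integral_Icc_eq_Ioo[OF f]
    set_lebesgue_integral_eq_integral(2)[OF f] by (simp add: integral_unique)

section \<open>Square-integrable functions\<close>

lemma set_borel_measurable_bilinear:
  fixes f :: "'a \<Rightarrow> 'u::euclidean_space" and g :: "'a \<Rightarrow> 'v::euclidean_space"
  assumes b: "bounded_bilinear pr" and "set_borel_measurable M J f" "set_borel_measurable M J g"
  shows "set_borel_measurable M J (\<lambda>x. pr (f x) (g x))"
proof -
  interpret bounded_bilinear pr by fact
  have eq: "indicator J x *\<^sub>R pr (f x) (g x) = pr (indicator J x *\<^sub>R f x) (indicator J x *\<^sub>R g x)" for x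
    by (auto simp: indicator_def zero_left)
  show ?thesis
    using assms(2,3) unfolding set_borel_measurable_def eq
    by (rule borel_measurable_continuous_Pair) (intro bounded_bilinear.continuous_on[OF b] continuous_intros)
qed

lemma set_borel_measurable_linear:
  assumes "bounded_linear T" "set_borel_measurable M J f"
  shows "set_borel_measurable M J (\<lambda>x. T (f x))"
proof -
  have eq: "indicator J x *\<^sub>R T (f x) = T (indicator J x *\<^sub>R f x)" for x
    by (simp add: linear_cmul[OF bounded_linear.linear[OF assms(1)]])
  show ?thesis
    using assms(2) unfolding set_borel_measurable_def eq
    by (intro borel_measurable_continuous_on[OF _ assms(2)[unfolded set_borel_measurable_def]]
        linear_continuous_on assms(1))
qed

lemma set_integrable_bilinear_bounded:
  fixes f :: "real \<Rightarrow> 'u::euclidean_space" and g :: "real \<Rightarrow> 'v::euclidean_space"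
    and pr :: "'u \<Rightarrow> 'v \<Rightarrow> 'w::euclidean_space"
  assumes b: "bounded_bilinear pr" and f: "set_integrable lebesgue J f" and g: "set_borel_measurable lebesgue J g"
    and bd: "bounded (g ` J)"
  shows "set_integrable lebesgue J (\<lambda>x. pr (f x) (g x))"
proof -
  obtain K where K: "K > 0" "\<And>u v. norm (pr u v) \<le> norm u * norm v * K"
    using bounded_bilinear.pos_bounded[OF b] by blast
  obtain M where M: "\<And>x. x \<in> J \<Longrightarrow> norm (g x) \<le> M" using bd by (auto simp: bounded_iff)
  show ?thesis
  proof (rule set_integrable_bound)
    show "set_integrable lebesgue J (\<lambda>x. (M * K) *\<^sub>R f x)" using f by simp
    show "set_borel_measurable lebesgue J (\<lambda>x. pr (f x) (g x))"
      by (rule set_borel_measurable_bilinear[OF b set_integrable_imp_set_borel_measurable[OF f] g])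
    have "norm (pr (f x) (g x)) \<le> norm ((M * K) *\<^sub>R f x)" if "x \<in> J" for x
    proof -
      have "norm (f x) * norm (g x) * K \<le> norm (f x) * \<bar>M\<bar> * K"
        using M[OF that] K(1) by (intro mult_right_mono mult_left_mono) auto
      then show ?thesis using K by (intro order_trans[OF K(2)]) (simp add: mult_ac abs_mult)
    qed
    then show "AE x in lebesgue. x \<in> J \<longrightarrow> norm (pr (f x) (g x)) \<le> norm ((M * K) *\<^sub>R f x)"
      by (intro AE_I2) auto
  qed
qed

lemma L2_onD:
  assumes "L2_on J f"
  shows "set_borel_measurable lebesgue J f" "set_integrable lebesgue J (\<lambda>x. (norm (f x))\<^sup>2)"
  using assms unfolding L2_on_def by blast+

lemma L2_on_cong:
  fixes f g :: "real \<Rightarrow> 'v::euclidean_space"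
  assumes "\<And>x. x \<in> J \<Longrightarrow> f x = g x"
  shows "L2_on J f \<longleftrightarrow> L2_on J g"
proof -
  have "(\<lambda>x. indicator J x *\<^sub>R f x) = (\<lambda>x. indicator J x *\<^sub>R g x)"
    "(\<lambda>x. indicator J x *\<^sub>R (norm (f x))\<^sup>2) = (\<lambda>x. indicator J x *\<^sub>R (norm (g x))\<^sup>2)"
    using assms by (auto simp: indicator_def fun_eq_iff)
  then show ?thesis by (simp add: L2_on_def set_borel_measurable_def set_integrable_def)
qed

lemma L2_on_bound:
  fixes f :: "real \<Rightarrow> 'u::euclidean_space" and g :: "real \<Rightarrow> 'v::euclidean_space"
  assumes f: "L2_on J f" and g: "set_borel_measurable lebesgue J g"
    and le: "\<And>x. x \<in> J \<Longrightarrow> norm (g x) \<le> M * norm (f x)" and J: "J \<in> sets lebesgue"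
  shows "L2_on J g"
  unfolding L2_on_def
proof
  show "set_integrable lebesgue J (\<lambda>x. (norm (g x))\<^sup>2)"
  proof (rule set_integrable_bound)
    show "set_integrable lebesgue J (\<lambda>x. M\<^sup>2 * (norm (f x))\<^sup>2)" using f by (simp add: L2_on_def)
    have eq: "indicator J x *\<^sub>R (norm (g x))\<^sup>2 = (norm (indicator J x *\<^sub>R g x))\<^sup>2" for x
      by (simp add: indicator_def)
    show "set_borel_measurable lebesgue J (\<lambda>x. (norm (g x))\<^sup>2)"
      using g unfolding set_borel_measurable_def eq by (intro borel_measurable_power measurable_compose[OF _ borel_measurable_norm])
    show "AE x in lebesgue. x \<in> J \<longrightarrow> norm ((norm (g x))\<^sup>2) \<le> norm (M\<^sup>2 * (norm (f x))\<^sup>2)"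
      using power_mono[OF le norm_ge_zero, of _ 2] by (intro AE_I2) (auto simp: power_mult_distrib)
  qed
qed fact

text \<open>For mere integrability the elementary bound of \<open>norm u * norm v\<close> by the sum
  of the squares takes the place of the Cauchy-Schwarz inequality.\<close>

lemma set_integrable_L2_prod:
  fixes f :: "real \<Rightarrow> 'u::euclidean_space" and g :: "real \<Rightarrow> 'v::euclidean_space"
    and pr :: "'u \<Rightarrow> 'v \<Rightarrow> 'w::euclidean_space"
  assumes b: "bounded_bilinear pr" and f: "L2_on J f" and g: "L2_on J g"
  shows "set_integrable lebesgue J (\<lambda>x. pr (f x) (g x))"
proof -
  obtain K where K: "K > 0" "\<And>u v. norm (pr u v) \<le> norm u * norm v * K"
    using bounded_bilinear.pos_bounded[OF b] by blast
  show ?thesis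
  proof (rule set_integrable_bound)
    show "set_integrable lebesgue J (\<lambda>x. K * ((norm (f x))\<^sup>2 + (norm (g x))\<^sup>2))"
      by (intro set_integrable_mult_right set_integral_add(1) L2_onD(2) f g)
    show "set_borel_measurable lebesgue J (\<lambda>x. pr (f x) (g x))"
      by (rule set_borel_measurable_bilinear[OF b L2_onD(1)[OF f] L2_onD(1)[OF g]])
    have "norm (pr u v) \<le> K * ((norm u)\<^sup>2 + (norm v)\<^sup>2)" for u v
    proof -
      have "norm u * norm v \<le> (norm u)\<^sup>2 + (norm v)\<^sup>2"
        using sum_squares_bound[of "norm u" "norm v"] mult_nonneg_nonneg[OF norm_ge_zero[of u] norm_ge_zero[of v]]
        by linarith
      then have "K * (norm u * norm v) \<le> K * ((norm u)\<^sup>2 + (norm v)\<^sup>2)" using K(1) by simp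
      then show ?thesis using K(2)[of u v] by (simp add: mult.commute)
    qed
    then show "AE x in lebesgue. x \<in> J \<longrightarrow> norm (pr (f x) (g x)) \<le> norm (K * ((norm (f x))\<^sup>2 + (norm (g x))\<^sup>2))"
      using K(1) by (intro AE_I2 impI) (metis abs_ge_self order_trans real_norm_def)
  qed
qed

lemma L2_on_bounded_linear:
  fixes f :: "real \<Rightarrow> 'u::euclidean_space" and T :: "'u \<Rightarrow> 'v::euclidean_space"
  assumes "bounded_linear T" "L2_on J f" "J \<in> sets lebesgue"
  shows "L2_on J (\<lambda>x. T (f x))"
proof -
  obtain K where "\<And>u. norm (T u) \<le> norm u * K"
    using bounded_linear.bounded[OF assms(1)] by blast
  then show ?thesis
    by (intro L2_on_bound[OF assms(2) _ _ assms(3), where M=K]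
        set_borel_measurable_linear[OF assms(1) L2_onD(1)[OF assms(2)]]) (simp add: mult.commute)
qed

lemma L2_on_bilinear_bounded:
  fixes f :: "real \<Rightarrow> 'u::euclidean_space" and g :: "real \<Rightarrow> 'v::euclidean_space"
    and pr :: "'u \<Rightarrow> 'v \<Rightarrow> 'w::euclidean_space"
  assumes b: "bounded_bilinear pr" and f: "L2_on J f" and g: "set_borel_measurable lebesgue J g"
    and bd: "bounded (g ` J)" and J: "J \<in> sets lebesgue"
  shows "L2_on J (\<lambda>x. pr (f x) (g x))"
proof -
  obtain K where K: "K > 0" "\<And>u v. norm (pr u v) \<le> norm u * norm v * K"
    using bounded_bilinear.pos_bounded[OF b] by blast
  obtain M where M: "\<And>x. x \<in> J \<Longrightarrow> norm (g x) \<le> M" using bd by (auto simp: bounded_iff)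
  show ?thesis
  proof (rule L2_on_bound[OF f _ _ J, where M="M * K"])
    show "set_borel_measurable lebesgue J (\<lambda>x. pr (f x) (g x))"
      by (rule set_borel_measurable_bilinear[OF b L2_onD(1)[OF f] g])
    show "norm (pr (f x) (g x)) \<le> M * K * norm (f x)" if "x \<in> J" for x
    proof -
      have "norm (f x) * norm (g x) * K \<le> norm (f x) * M * K"
        using M[OF that] K(1) by (intro mult_right_mono mult_left_mono) auto
      then show ?thesis using K(2)[of "f x" "g x"] by (simp add: mult_ac)
    qed
  qed
qed

lemma L2_on_add:
  fixes f g :: "real \<Rightarrow> 'u::euclidean_space"
  assumes f: "L2_on J f" and g: "L2_on J g"
  shows "L2_on J (\<lambda>x. f x + g x)"
  unfolding L2_on_def
proof
  show m: "set_borel_measurable lebesgue J (\<lambda>x. f x + g x)"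
    using L2_onD(1)[OF f] L2_onD(1)[OF g] unfolding set_borel_measurable_def scaleR_add_right
    by (rule borel_measurable_add)
  show "set_integrable lebesgue J (\<lambda>x. (norm (f x + g x))\<^sup>2)"
  proof (rule set_integrable_bound)
    show "set_integrable lebesgue J (\<lambda>x. 2 * ((norm (f x))\<^sup>2 + (norm (g x))\<^sup>2))"
      by (intro set_integrable_mult_right set_integral_add(1) L2_onD(2) f g)
    have eq: "indicator J x *\<^sub>R (norm (f x + g x))\<^sup>2 = (norm (indicator J x *\<^sub>R (f x + g x)))\<^sup>2" for x
      by (simp add: indicator_def)
    show "set_borel_measurable lebesgue J (\<lambda>x. (norm (f x + g x))\<^sup>2)"
      using m unfolding set_borel_measurable_def eq by (intro borel_measurable_power measurable_compose[OF _ borel_measurable_norm])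
    have "(norm (f x + g x))\<^sup>2 \<le> 2 * ((norm (f x))\<^sup>2 + (norm (g x))\<^sup>2)" for x
    proof -
      have "(norm (f x + g x))\<^sup>2 \<le> (norm (f x) + norm (g x))\<^sup>2"
        by (intro power_mono norm_triangle_ineq) simp
      also have "\<dots> \<le> 2 * ((norm (f x))\<^sup>2 + (norm (g x))\<^sup>2)"
        using sum_squares_bound[of "norm (f x)" "norm (g x)"] by (simp add: power2_sum)
      finally show ?thesis .
    qed
    then show "AE x in lebesgue. x \<in> J \<longrightarrow> norm ((norm (f x + g x))\<^sup>2) \<le> norm (2 * ((norm (f x))\<^sup>2 + (norm (g x))\<^sup>2))"
      by (intro AE_I2 impI) (metis abs_ge_self abs_power2 real_norm_def order_trans)
  qed
qed

section \<open>Complex matrices\<close>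

lemma cscale_nth [simp]: "(c *\<^sub>c M) $ i $ j = c * M $ i $ j"
  by (simp add: cscale_def)

lemma matrix_add_rdist: "(A + B) ** C = A ** C + B ** C"
  for A B :: "complex ^ 'n ^ 'm"
  by (auto simp: vec_eq_iff matrix_matrix_mult_def sum.distrib algebra_simps)

lemma scaleR_matrix_mult:
  fixes A :: "complex ^ 'n ^ 'm" and B :: "complex ^ 'p ^ 'n"
  shows "(r *\<^sub>R A) ** B = r *\<^sub>R (A ** B)" "A ** (r *\<^sub>R B) = r *\<^sub>R (A ** B)"
  by (auto simp: vec_eq_iff matrix_matrix_mult_def scaleR_sum_right)

lemma matrix_vector_mult_axis: "(A *v axis j 1) $ k = A $ k $ j"
  for A :: "complex ^ 'n ^ 'm"
  by (simp add: matrix_vector_mult_def axis_def if_distrib cong: if_cong)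

lemma matrix_vector_mult_uminus: "(- A) *v v = - (A *v v)"
  for A :: "complex ^ 'n ^ 'm"
  by (simp add: vec_eq_iff matrix_vector_mult_def sum_negf)

lemma cscale_matrix_mult:
  "(c *\<^sub>c A) ** B = c *\<^sub>c (A ** B)" "A ** (c *\<^sub>c B) = c *\<^sub>c (A ** B)"
  by (auto simp: vec_eq_iff matrix_matrix_mult_def sum_distrib_left algebra_simps)

lemma cscale_matrix_vector_mult:
  "(c *\<^sub>c A) *v x = c *s (A *v x)" "A *v (c *s x) = c *s (A *v x)"
  by (auto simp: vec_eq_iff matrix_vector_mult_def sum_distrib_left algebra_simps)

lemma bounded_linear_cscale: "bounded_linear (\<lambda>M :: complex ^ 'l ^ 'k. c *\<^sub>c M)"
  by (intro linear_conv_bounded_linear[THEN iffD1] linearI)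
    (auto simp: vec_eq_iff algebra_simps)

lemma bounded_linear_vector_scalar_mult: "bounded_linear (\<lambda>v :: complex ^ 'k. c *s v)"
  by (intro linear_conv_bounded_linear[THEN iffD1] linearI)
    (auto simp: vec_eq_iff algebra_simps)

lemma bounded_bilinear_matrix_mult:
  "bounded_bilinear (\<lambda>(A :: complex ^ 'n ^ 'm) (B :: complex ^ 'p ^ 'n). A ** B)"
  by (rule bilinear_conv_bounded_bilinear[THEN iffD1])
    (auto simp: bilinear_def scaleR_matrix_mult matrix_add_ldistrib matrix_add_rdist intro!: linearI)

lemma bounded_bilinear_matrix_vector_mult:
  "bounded_bilinear (\<lambda>(A :: complex ^ 'n ^ 'm) (v :: complex ^ 'n). A *v v)"
  by (rule bilinear_conv_bounded_bilinear[THEN iffD1])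
    (auto simp: bilinear_def matrix_vector_mult_def vec_eq_iff scaleR_sum_right sum.distrib algebra_simps intro!: linearI)

lemma set_integral_mult_vec:
  fixes f :: "'a \<Rightarrow> complex ^ 'k ^ 'l"
  assumes "set_integrable M S f"
  shows "set_integrable M S (\<lambda>t. f t *v v)"
    "(LINT t:S|M. f t *v v) = (LINT t:S|M. f t) *v v"
  using set_integral_bounded_linear[OF bounded_bilinear.bounded_linear_left[OF bounded_bilinear_matrix_vector_mult] assms]
  by auto

lemma det_nonzero_iff_ker:
  fixes A :: "complex ^ 'n ^ 'n"
  shows "det A \<noteq> 0 \<longleftrightarrow> (\<forall>v. A *v v = 0 \<longrightarrow> v = 0)"
  by (metis invertible_det_nz invertible_left_inverse matrix_left_invertible_ker)

lemma invertible_matrix_inv: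
  fixes A :: "complex ^ 'n ^ 'n"
  assumes "invertible A"
  shows "A ** matrix_inv A = mat 1" "matrix_inv A ** A = mat 1"
  using someI_ex[OF assms[unfolded invertible_def]] unfolding matrix_inv_def by auto

lemma matrix_inv_mat_1: "matrix_inv (mat 1 :: complex ^ 'n ^ 'n) = mat 1"
  using invertible_matrix_inv(1)[of "mat 1 :: complex ^ 'n ^ 'n"] by (auto simp: invertible_def)

text \<open>Column \<open>j\<close> of the inverse solves a linear system with right-hand side
  \<open>axis j 1\<close>. Cramer's rule writes its entries as quotients of determinants, from which
  continuity of the inverse can be read off.\<close>

lemma matrix_inv_cramer:
  fixes A :: "complex ^ 'n ^ 'n"
  assumes "invertible A"
  shows "matrix_inv A = (\<chi> k j. det (\<chi> i l. if l = k then axis j 1 $ i else A $ i $ l) / det A)"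
proof -
  have d: "det A \<noteq> 0" using assms by (simp add: invertible_det_nz)
  have "A *v (matrix_inv A *v axis j 1) = axis j 1" for j
    by (simp add: matrix_vector_mul_assoc invertible_matrix_inv[OF assms])
  then have "matrix_inv A *v axis j 1 = (\<chi> k. det (\<chi> i l. if l = k then axis j 1 $ i else A $ i $ l) / det A)" for j
    using cramer[OF d, of "matrix_inv A *v axis j 1" "axis j 1"] by simp
  then have "(matrix_inv A *v axis j 1) $ k = det (\<chi> i l. if l = k then axis j 1 $ i else A $ i $ l) / det A" for j k
    by simp
  then show ?thesis by (simp add: vec_eq_iff matrix_vector_mult_axis)
qed

lemma continuous_on_det:
  fixes M :: "'a::topological_space \<Rightarrow> complex ^ 'n ^ 'n"
  assumes "continuous_on S M"
  shows "continuous_on S (\<lambda>x. det (M x))"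
  unfolding det_def by (intro continuous_intros assms)

lemma continuous_on_matrix_inv:
  fixes M :: "'a::topological_space \<Rightarrow> complex ^ 'n ^ 'n"
  assumes M: "continuous_on S M" and inv: "\<And>x. x \<in> S \<Longrightarrow> invertible (M x)"
  shows "continuous_on S (\<lambda>x. matrix_inv (M x))"
proof -
  have "continuous_on S (\<lambda>x. \<chi> k j. det (\<chi> i l. if l = k then axis j 1 $ i else M x $ i $ l) / det (M x))"
  proof (intro continuous_on_vec_lambda continuous_on_divide continuous_on_det M)
    fix k j i l
    show "continuous_on S (\<lambda>x. if l = k then axis j 1 $ i else M x $ i $ l)"
      by (cases "l = k") (auto intro!: continuous_intros M)
  qed (use inv in \<open>auto simp: invertible_det_nz\<close>)
  then show ?thesis
    by (rule continuous_on_cong[THEN iffD1, rotated 2]) (auto simp: matrix_inv_cramer inv)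
qed

section \<open>Linear systems with integrable coefficients\<close>

text \<open>
  Let \<open>s\<close> be the supremum of the points up to which \<open>z\<close> vanishes. If \<open>s < b\<close>, then the integral of \<open>k\<close>
  over some \<open>(s, t)\<close> is less than 1/2, so that the supremum of \<open>norm z\<close> up to \<open>t\<close> is at most half itself.
\<close>

lemma gronwall_zero:
  fixes z G :: "real \<Rightarrow> 'v::euclidean_space" and k :: "real \<Rightarrow> real"
  assumes k: "set_integrable lebesgue (einterval a b) k" and G: "set_integrable lebesgue (einterval a b) G"
    and Gz: "AE t\<in>einterval a b in lebesgue. norm (G t) \<le> k t * norm (z t)"
    and z: "\<And>x. x \<in> einterval a b \<Longrightarrow> z x = (LINT t:einterval a x|lebesgue. G t)"
  shows "\<forall>x\<in>einterval a b. z x = 0"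
proof (cases "a < b")
  case False
  then show ?thesis by (auto simp: einterval_iff)
next
  case ab: True
  \<comment> \<open>A nonnegative majorant is needed to enlarge the domain of integration further
    down.\<close>
  define k' where "k' = (\<lambda>t. \<bar>k t\<bar>)"
  have k': "set_integrable lebesgue (einterval a b) k'" using k by (simp add: k'_def set_integrable_abs)
  have Gz': "AE t\<in>einterval a b in lebesgue. norm (G t) \<le> k' t * norm (z t)"
    using Gz
  proof eventually_elim
    case (elim t)
    then show ?case unfolding k'_def
      by (meson abs_ge_self mult_right_mono norm_ge_zero order_trans)
  qed
  \<comment> \<open>As a set of extended reals \<open>Q\<close> has a supremum, and \<open>a\<close>
    belongs to it because \<open>einterval a a\<close> is empty.\<close>
  define Q where "Q = {x \<in> {a..b}. \<forall>y\<in>einterval a x. z y = 0}"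
  define s where "s = Sup Q"
  have aQ: "a \<in> Q" using ab by (auto simp: Q_def einterval_iff)
  have sab: "s \<in> {a..b}" unfolding s_def using aQ
    by (auto simp: Q_def intro: Sup_upper Sup_least)
  have sz: "z y = 0" if "y \<in> einterval a s" for y
  proof -
    have "ereal y < Sup Q" using that by (simp add: einterval_iff s_def)
    then obtain x where "x \<in> Q" "ereal y < x" using less_Sup_iff by blast
    then show ?thesis using that by (auto simp: Q_def einterval_iff)
  qed
  have "s = b"
  proof (rule ccontr)
    assume "s \<noteq> b"
    then have sb: "s < b" using sab by auto
    have ksb: "set_integrable lebesgue (einterval s b) k'"
      using set_integrable_einterval_subset[OF k'] sab by auto
    define \<Phi> where "\<Phi> = (\<lambda>x. LINT t:einterval s x|lebesgue. k' t)"
    have cont: "continuous_on {s..b} \<Phi>"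
      unfolding \<Phi>_def by (rule continuous_on_set_integral_einterval[OF ksb])
    have "\<Phi> s = 0" by (simp add: \<Phi>_def einterval_same set_lebesgue_integral_def)
    moreover have "(\<Phi> \<longlongrightarrow> \<Phi> s) (at_right s)"
      using cont sb by (auto simp: continuous_on_Icc_at_rightD)
    ultimately have "\<forall>\<^sub>F x in at_right s. \<Phi> x < 1/2"
      by (intro order_tendstoD(2)[of \<Phi> "\<Phi> s"]) auto
    then obtain b' where b': "b' > s" "\<And>x. s < x \<Longrightarrow> x < b' \<Longrightarrow> \<Phi> x < 1/2"
      unfolding eventually_at_right[OF sb] by blast
    obtain t where "s < t" "t < min b' b" using dense[of s "min b' b"] b'(1) sb by auto
    then have t: "\<Phi> t < 1/2" "s < t" "t < b" using b' by auto
    have kst: "set_integrable lebesgue (einterval s t) k'"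
      using set_integrable_einterval_subset[OF ksb] t by auto
    define M where "M = (SUP x\<in>einterval a t. norm (z x))"
    have Gab: "set_integrable lebesgue (einterval a x) G" if "x \<le> b" for x
      using set_integrable_einterval_subset[OF G] that by auto
    \<comment> \<open>A real supremum is meaningful only for a bounded set; the bound is the
      integral of \<open>norm G\<close> over the whole interval.\<close>
    have bdd: "bdd_above ((\<lambda>x. norm (z x)) ` einterval a t)"
    proof (rule bdd_aboveI2)
      fix x assume x: "x \<in> einterval a t"
      then have xb: "x \<in> einterval a b" using t by (auto simp: einterval_iff)
      have "norm (z x) \<le> (LINT t:einterval a x|lebesgue. norm (G t))"
        unfolding z[OF xb] using xb by (intro set_integral_norm_bound Gab) (auto simp: einterval_iff)
      also have "\<dots> \<le> (LINT t:einterval a b|lebesgue. norm (G t))"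
        unfolding set_lebesgue_integral_def
      proof (rule integral_mono)
        show "integrable lebesgue (\<lambda>t. indicator (einterval a x) t *\<^sub>R norm (G t))"
          "integrable lebesgue (\<lambda>t. indicator (einterval a b) t *\<^sub>R norm (G t))"
          using set_integrable_norm[OF Gab[of x]] set_integrable_norm[OF G] xb unfolding set_integrable_def by (auto simp: einterval_iff)
        show "indicator (einterval a x) t *\<^sub>R norm (G t) \<le> indicator (einterval a b) t *\<^sub>R norm (G t)" for t
        proof -
          have "einterval a x \<subseteq> einterval a b" using xb by (intro einterval_mono) (auto simp: einterval_iff)
          then show ?thesis by (auto simp: indicator_def)
        qed
      qed
      finally show "norm (z x) \<le> (LINT t:einterval a b|lebesgue. norm (G t))" .
    qed
    have ne: "einterval a t \<noteq> {}" using einterval_nonempty[of a t] le_less_trans[of a s t] sab t by auto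
    have zM: "norm (z x) \<le> M" if "x \<in> einterval a t" for x
      unfolding M_def using bdd that by (intro cSUP_upper)
    have M0: "M \<ge> 0" using ne zM by (meson all_not_in_conv norm_ge_zero order_trans)
    have half: "norm (z x) \<le> M / 2" if x: "x \<in> einterval a t" for x
    proof (cases "ereal x < s")
      case True
      then show ?thesis using sz[of x] x M0 by (auto simp: einterval_iff)
    next
      case False
      then have sx: "s \<le> ereal x" by simp
      have xb: "x \<in> einterval a b" using x t by (auto simp: einterval_iff)
      have "norm (z x) \<le> (LINT y:einterval a x|lebesgue. norm (G y))"
        unfolding z[OF xb] using xb by (intro set_integral_norm_bound Gab) (auto simp: einterval_iff)
      \<comment> \<open>Up to \<open>s\<close> the integrand vanishes almost everywhere together
        with \<open>z\<close>; beyond \<open>s\<close> it is at most \<open>k'\<close> times the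
        supremum \<open>M\<close>.\<close>
      also have "\<dots> \<le> (LINT y:einterval s t|lebesgue. M * k' y)"
        unfolding set_lebesgue_integral_def
      proof (rule integral_mono_AE)
        show "integrable lebesgue (\<lambda>y. indicator (einterval a x) y *\<^sub>R norm (G y))"
          using set_integrable_norm[OF Gab[of x]] xb unfolding set_integrable_def by (auto simp: einterval_iff)
        show "integrable lebesgue (\<lambda>y. indicator (einterval s t) y *\<^sub>R (M * k' y))"
          using kst unfolding set_integrable_def[symmetric] by simp
        show "AE y in lebesgue. indicator (einterval a x) y *\<^sub>R norm (G y) \<le> indicator (einterval s t) y *\<^sub>R (M * k' y)"
          using Gz' AE_lebesgue_neq[of s]
        proof eventually_elim
          case (elim y)
          show ?case
          proof (cases "y \<in> einterval a x")
            case False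
            then show ?thesis using M0 by (simp add: k'_def indicator_def)
          next
            case True
            then have yab: "y \<in> einterval a b" and yat: "y \<in> einterval a t"
              using xb x less_trans[of "ereal y" "ereal x"] by (auto simp: einterval_iff)
            have Gy: "norm (G y) \<le> k' y * norm (z y)" using elim yab by blast
            show ?thesis
            proof (cases "ereal y < s")
              case True
              then have "z y = 0" using sz yab by (auto simp: einterval_iff)
              then have "norm (G y) = 0" using Gy by simp
              then show ?thesis using M0 by (simp add: k'_def indicator_def)
            next
              case False
              then have "y \<in> einterval s t" using elim yat by (auto simp: einterval_iff)
              moreover have "k' y * norm (z y) \<le> M * k' y"
                using mult_left_mono[OF zM[OF yat], of "k' y"] by (simp add: k'_def mult.commute)
              ultimately show ?thesis using Gy True by simp
            qed
          qed
        qed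
      qed
      also have "\<dots> = M * \<Phi> t" by (simp add: \<Phi>_def)
      also have "\<dots> \<le> M * (1/2)" using t M0 by (intro mult_left_mono) auto
      finally show ?thesis by simp
    qed
    have "M \<le> M / 2" unfolding M_def[symmetric]
      using cSUP_least[OF ne half] by (simp add: M_def)
    then have "M = 0" using M0 by simp
    then have "t \<in> Q" using zM t sab by (fastforce simp: Q_def)
    then have "t \<le> s" unfolding s_def by (rule Sup_upper)
    then show False using t by simp
  qed
  then show ?thesis using sz by simp
qed

text \<open>The mirror image of \<open>gronwall_zero\<close>: all functions, and the exceptional
  null set with them, are reflected at the origin.\<close>

lemma gronwall_zero_right:
  fixes z G :: "real \<Rightarrow> 'v::euclidean_space" and k :: "real \<Rightarrow> real"
  assumes k: "set_integrable lebesgue (einterval a b) k" and G: "set_integrable lebesgue (einterval a b) G"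
    and Gz: "AE t\<in>einterval a b in lebesgue. norm (G t) \<le> k t * norm (z t)"
    and z: "\<And>x. x \<in> einterval a b \<Longrightarrow> z x = (LINT t:einterval x b|lebesgue. G t)"
  shows "\<forall>x\<in>einterval a b. z x = 0"
proof -
  have mem: "- x \<in> einterval a b \<longleftrightarrow> x \<in> einterval (-b) (-a)" for x
    by (cases a; cases b) (auto simp: einterval_def)
  have "\<forall>x\<in>einterval (-b) (-a). z (-x) = 0"
  proof (rule gronwall_zero[where k="\<lambda>t. k (-t)" and G="\<lambda>t. G (-t)"])
    show "set_integrable lebesgue (einterval (-b) (-a)) (\<lambda>t. k (-t))"
      "set_integrable lebesgue (einterval (-b) (-a)) (\<lambda>t. G (-t))"
      using k G by (simp_all add: set_integral_reflect_einterval(1))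
    obtain N where N: "N \<in> null_sets lebesgue" "{t. \<not> (t \<in> einterval a b \<longrightarrow> norm (G t) \<le> k t * norm (z t))} \<subseteq> N"
      using Gz by (auto simp: eventually_ae_filter)
    have "negligible (uminus ` N)"
      using N by (intro negligible_uminus_image) (auto simp: negligible_iff_null_sets)
    then have "AE t in lebesgue. t \<notin> uminus ` N" by (simp add: negligible_iff_null_sets AE_not_in)
    then show "AE t\<in>einterval (-b) (-a) in lebesgue. norm (G (-t)) \<le> k (-t) * norm (z (-t))"
    proof eventually_elim
      case (elim t)
      then have "-t \<notin> N" by (metis image_eqI minus_minus)
      then show ?case using N(2) mem by auto
    qed
    show "z (-x) = (LINT t:einterval (-b) x|lebesgue. G (-t))" if "x \<in> einterval (-b) (-a)" for x
      using z[of "-x"] mem that set_integral_reflect_einterval(2)[of b "ereal (-x)" G] by simp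
  qed
  then show ?thesis using mem by (metis minus_minus)
qed

text \<open>Uniqueness for \<open>z' = M z\<close> in integrated form, from a zero at either end of
  a possibly infinite interval, by Gronwall with \<open>k\<close> a multiple of
  \<open>norm M\<close>. The integrand \<open>G\<close> is kept apart from \<open>M z\<close>
  because for \<open>U\<close> the two agree only almost everywhere.\<close>

lemma linear_system_zero:
  fixes M :: "real \<Rightarrow> complex ^ 'n ^ 'n" and z :: "ereal \<Rightarrow> complex ^ 'n" and G :: "real \<Rightarrow> complex ^ 'n"
  assumes M: "set_integrable lebesgue (einterval x y) M" and G: "set_integrable lebesgue (einterval x y) G"
    and GM: "AE t\<in>einterval x y in lebesgue. G t = M t *v z (ereal t)"
    and diff: "\<And>s t. x \<le> s \<Longrightarrow> s \<le> t \<Longrightarrow> t \<le> y \<Longrightarrow> z t - z s = (LINT r:einterval s t|lebesgue. G r)"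
    and zero: "z x = 0 \<or> z y = 0" and t: "t \<in> {x..y}"
  shows "z t = 0"
proof -
  obtain K where K: "K > 0" "\<And>(A :: complex ^ 'n ^ 'n) v. norm (A *v v) \<le> norm A * norm v * K"
    using bounded_bilinear.pos_bounded[OF bounded_bilinear_matrix_vector_mult] by blast
  define k where "k = (\<lambda>t. K * norm (M t))"
  have k: "set_integrable lebesgue (einterval x y) k"
    unfolding k_def by (intro set_integrable_mult_right set_integrable_norm M)
  have Gk: "AE t\<in>einterval x y in lebesgue. norm (G t) \<le> k t * norm (z (ereal t))"
    using GM
  proof eventually_elim
    case (elim t)
    then show ?case using K(2)[of "M t" "z (ereal t)"] by (auto simp: k_def mult_ac)
  qed
  have xy: "x \<le> y" using t by auto
  have zi: "\<forall>t\<in>einterval x y. z (ereal t) = 0"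
    using zero
  proof
    assume zx: "z x = 0"
    show ?thesis
    proof (rule gronwall_zero[OF k G Gk])
      show "z (ereal t) = (LINT r:einterval x t|lebesgue. G r)" if "t \<in> einterval x y" for t
        using diff[of x "ereal t"] zx that by (simp add: einterval_iff less_imp_le)
    qed
  next
    assume zy: "z y = 0"
    have G': "set_integrable lebesgue (einterval x y) (\<lambda>t. - G t)"
      using set_integral_bounded_linear(1)[OF bounded_linear_minus[OF bounded_linear_ident] G] by simp
    show ?thesis
    proof (rule gronwall_zero_right[OF k G'])
      show "AE t\<in>einterval x y in lebesgue. norm (- G t) \<le> k t * norm (z (ereal t))"
        using Gk by simp
      show "z (ereal t) = (LINT r:einterval t y|lebesgue. - G r)" if t: "t \<in> einterval x y" for t
      proof -
        have "set_integrable lebesgue (einterval t y) G"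
          using set_integrable_einterval_subset[OF G, of t y] t by (simp add: einterval_iff less_imp_le)
        then have "(LINT r:einterval t y|lebesgue. - G r) = - (LINT r:einterval t y|lebesgue. G r)"
          by (rule set_integral_uminus)
        also have "\<dots> = - (z y - z (ereal t))"
          using diff[of "ereal t" y] t by (simp add: einterval_iff less_imp_le)
        finally show ?thesis using zy by simp
      qed
    qed
  qed
  \<comment> \<open>Gronwall covers interior points only. The ends, possibly infinite, are reached
    through the increments: \<open>G\<close> vanishes almost everywhere, so \<open>z\<close> is
    constant on the closed interval.\<close>
  have "(LINT r:einterval s t|lebesgue. G r) = 0" if "x \<le> s" "t \<le> y" for s t
  proof -
    have "(LINT r:einterval s t|lebesgue. G r) = (LINT r:einterval s t|lebesgue. 0)"
      unfolding set_lebesgue_integral_def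
    proof (rule integral_cong_AE)
      have "set_integrable lebesgue (einterval s t) G"
        using set_integrable_einterval_subset[OF G that] .
      then show "(\<lambda>r. indicator (einterval s t) r *\<^sub>R G r) \<in> borel_measurable lebesgue"
        unfolding set_integrable_def by (rule borel_measurable_integrable)
      show "AE r in lebesgue. indicator (einterval s t) r *\<^sub>R G r = indicator (einterval s t) r *\<^sub>R 0"
        using GM
      proof eventually_elim
        case (elim r)
        have "einterval s t \<subseteq> einterval x y" using that by (rule einterval_mono)
        then show ?case using elim zi by (auto simp: indicator_def)
      qed
    qed simp
    then show ?thesis by simp
  qed
  then have "z t = z s" if "x \<le> s" "s \<le> t" "t \<le> y" for s t
    using diff[OF that] that by simp
  then show ?thesis using zero t xy by (metis atLeastAtMost_iff order_refl)
qed

section \<open>Integral operators with semi-separable kernels\<close>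

text \<open>
  For a projection \<open>P\<close>, this is the primitive \<open>z\<close> of \<open>h\<close> on \<open>[a, b]\<close> with \<open>(1 - P) z a = 0\<close> and
  \<open>P z b = 0\<close>.
\<close>

definition split_primitive ::
  "ereal \<Rightarrow> ereal \<Rightarrow> complex ^ 'n ^ 'n \<Rightarrow> (real \<Rightarrow> complex ^ 'n) \<Rightarrow> ereal \<Rightarrow> complex ^ 'n"
  where "split_primitive a b P h x =
    (mat 1 - P) *v (LINT y:einterval a x|lebesgue. h y) - P *v (LINT y:einterval x b|lebesgue. h y)"

text \<open>The two parts grow by \<open>1 - P\<close> and by \<open>P\<close> times the same
  integral, and these matrices add up to the identity.\<close>

lemma split_primitive_diff:
  assumes h: "set_integrable lebesgue (einterval a b) h" and "a \<le> x" "x \<le> y" "y \<le> b"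
  shows "split_primitive a b P h y - split_primitive a b P h x = (LINT t:einterval x y|lebesgue. h t)"
proof -
  have "set_integrable lebesgue (einterval a y) h" "set_integrable lebesgue (einterval x b) h"
    using assms by (auto intro: set_integrable_einterval_subset[OF h])
  then show ?thesis
    using set_integral_einterval_combine[of a y h x] set_integral_einterval_combine[of x b h y] assms(2-)
    by (simp add: split_primitive_def algebra_simps)
qed

lemma split_primitive_left:
  assumes "P ** P = P"
  shows "P *v split_primitive a b P h a = split_primitive a b P h a"
  by (simp add: split_primitive_def einterval_same set_lebesgue_integral_def[of _ "{}"]
      vec.neg matrix_vector_mul_assoc assms)

lemma split_primitive_right:
  assumes "P ** P = P"
  shows "P *v split_primitive a b P h b = 0"
  by (simp add: split_primitive_def einterval_same set_lebesgue_integral_def[of _ "{}"]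
      algebra_simps matrix_vector_mul_assoc assms)

lemma continuous_on_split_primitive:
  fixes h :: "real \<Rightarrow> complex ^ 'n"
  assumes h: "set_integrable lebesgue (einterval a b) h" and "a \<le> b"
  shows "continuous_on {a..b} (split_primitive a b P h)"
proof -
  have "continuous_on {a..b} (\<lambda>x. split_primitive a b P h a + (LINT t:einterval a x|lebesgue. h t))"
    by (intro continuous_intros continuous_on_set_integral_einterval h)
  then show ?thesis
  proof (rule continuous_on_cong[THEN iffD1, OF refl, rotated])
    fix x assume "x \<in> {a..b}"
    then show "split_primitive a b P h a + (LINT t:einterval a x|lebesgue. h t) = split_primitive a b P h x"
      using split_primitive_diff[OF h, of a x P] by (auto simp: algebra_simps)
  qed
qed

text \<open>With the integrals replaced by increments of \<open>z\<close>, the right-hand side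
  becomes \<open>z x - (1 - P) z a - P z b\<close>, and the boundary conditions remove the last two
  terms.\<close>

lemma split_primitive_unique:
  assumes z: "\<And>x y. a \<le> x \<Longrightarrow> x \<le> y \<Longrightarrow> y \<le> b \<Longrightarrow> z y - z x = (LINT t:einterval x y|lebesgue. h t)"
    and "P *v z a = z a" "P *v z b = 0" and x: "x \<in> {a..b}"
  shows "z x = split_primitive a b P h x"
proof -
  have "(LINT t:einterval a x|lebesgue. h t) = z x - z a" "(LINT t:einterval x b|lebesgue. h t) = z b - z x"
    using z[of a x] z[of x b] x by auto
  then have "split_primitive a b P h x = (mat 1 - P) *v (z x - z a) - P *v (z b - z x)"
    by (simp only: split_primitive_def)
  then show ?thesis using assms(2,3) by (simp add: algebra_simps)
qed

text \<open>On either side of the diagonal the kernel is a factor depending on \<open>x\<close>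
  times the common factor \<open>matrix_inv (W y) ** B y\<close>. The former leaves the integral;
  the projections with their signs combine the two remaining integrals into a split
  primitive.\<close>

lemma integral_operator_L_kernel:
  assumes h: "set_integrable lebesgue (einterval a b) (\<lambda>y. matrix_inv (W y) *v (B y *v \<phi> y))"
    and x: "x \<in> einterval a b"
  shows "integral_operator (einterval a b) (L_kernel C B W P) \<phi> x
    = C x *v (W x *v split_primitive a b P (\<lambda>y. matrix_inv (W y) *v (B y *v \<phi> y)) (ereal x))"
proof -
  define h where "h = (\<lambda>y. matrix_inv (W y) *v (B y *v \<phi> y))"
  note hh = assms(1)[folded h_def]
  define X Y where "X = C x ** W x ** (mat 1 - P)" and "Y = - (C x ** W x ** P)"
  have eq: "L_kernel C B W P x y *v \<phi> y = (if y < x then X *v h y else if x < y then Y *v h y else 0)" for y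
    by (simp add: L_kernel_def h_def X_def Y_def matrix_vector_mul_assoc[symmetric] matrix_vector_mult_uminus)
  have "integral_operator (einterval a b) (L_kernel C B W P) \<phi> x
    = (LINT y:einterval a x|lebesgue. X *v h y) + (LINT y:einterval x b|lebesgue. Y *v h y)"
    unfolding integral_operator_def eq
    by (intro set_integral_split_at x set_integral_bounded_linear(1)[OF _ hh]
        bounded_bilinear.bounded_linear_right[OF bounded_bilinear_matrix_vector_mult])
  also have "\<dots> = X *v (LINT y:einterval a x|lebesgue. h y) + Y *v (LINT y:einterval x b|lebesgue. h y)"
  proof -
    have "set_integrable lebesgue (einterval a x) h" "set_integrable lebesgue (einterval x b) h"
      using x by (auto intro!: set_integrable_einterval_subset[OF hh] simp: einterval_iff less_imp_le)
    then show ?thesis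
      by (simp add: set_integral_bounded_linear(2)[OF bounded_bilinear.bounded_linear_right[OF bounded_bilinear_matrix_vector_mult]])
  qed
  finally show ?thesis
    unfolding h_def[symmetric]
    by (simp add: X_def Y_def split_primitive_def matrix_vector_mul_assoc[symmetric] matrix_vector_mult_uminus algebra_simps)
qed

section \<open>Fundamental matrices\<close>

text \<open>\<open>F\<close> stands for the block row of the solutions of the two Volterra equations.\<close>

locale fundamental_matrix =
  fixes a b :: ereal and \<alpha> :: complex
    and B :: "real \<Rightarrow> complex ^ 'm ^ 'n" and C :: "real \<Rightarrow> complex ^ 'n ^ 'm"
    and F :: "real \<Rightarrow> complex ^ 'n ^ 'm"
    and U :: "ereal \<Rightarrow> complex ^ 'n ^ 'n" and P0 :: "complex ^ 'n ^ 'n"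
  assumes ab: "a < b"
    and B_L2: "L2_on (einterval a b) B" and C_L2: "L2_on (einterval a b) C" and F_L2: "L2_on (einterval a b) F"
    and F_eq: "AE x\<in>einterval a b in lebesgue. F x = C x ** U (ereal x)"
    and U_diff: "\<And>x y. a \<le> x \<Longrightarrow> x \<le> y \<Longrightarrow> y \<le> b \<Longrightarrow>
      U y - U x = (LINT t:einterval x y|lebesgue. \<alpha> *\<^sub>c (B t ** F t))"
    and P0_idem: "P0 ** P0 = P0"
    and U_a: "U a ** P0 = P0" and U_b: "U b ** (mat 1 - P0) = mat 1 - P0"
begin

abbreviation J where "J \<equiv> einterval a b"

text \<open>\<open>U\<close> is a primitive of \<open>G\<close> by assumption, whereas
  \<open>M U\<close> is the right-hand side of the differential equation. They are identified only
  almost everywhere, as the Volterra equations are.\<close>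

definition G where "G t = \<alpha> *\<^sub>c (B t ** F t)"
definition M where "M t = \<alpha> *\<^sub>c (B t ** C t)"

lemma G_int: "set_integrable lebesgue J G"
  unfolding G_def
  by (intro set_integral_bounded_linear(1)[OF bounded_linear_cscale]
      set_integrable_L2_prod[OF bounded_bilinear_matrix_mult] B_L2 F_L2)

lemma BC_int: "set_integrable lebesgue J (\<lambda>t. B t ** C t)"
  by (intro set_integrable_L2_prod[OF bounded_bilinear_matrix_mult] B_L2 C_L2)

lemma M_int: "set_integrable lebesgue J M"
  unfolding M_def by (intro set_integral_bounded_linear(1)[OF bounded_linear_cscale] BC_int)

lemma G_eq: "AE t\<in>J in lebesgue. G t = M t ** U (ereal t)"
  using F_eq by eventually_elim (auto simp: G_def M_def cscale_matrix_mult matrix_mul_assoc)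

lemma U_diff': "a \<le> x \<Longrightarrow> x \<le> y \<Longrightarrow> y \<le> b \<Longrightarrow> U y - U x = (LINT t:einterval x y|lebesgue. G t)"
  using U_diff by (simp add: G_def)

lemma J_D: "x \<in> J \<Longrightarrow> a \<le> ereal x" "x \<in> J \<Longrightarrow> ereal x \<le> b"
  by (auto simp: einterval_iff)

lemma U_cont: "continuous_on {a..b} U"
proof -
  have "continuous_on {a..b} (\<lambda>x. U a + (LINT t:einterval a x|lebesgue. G t))"
    by (intro continuous_intros continuous_on_set_integral_einterval G_int)
  then show ?thesis
  proof (rule continuous_on_cong[THEN iffD1, OF refl, rotated])
    fix x assume "x \<in> {a..b}"
    then show "U a + (LINT t:einterval a x|lebesgue. G t) = U x"
      using U_diff'[of a x] by (auto simp: algebra_simps)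
  qed
qed

lemma continuous_on_J:
  fixes f :: "ereal \<Rightarrow> 'v::topological_space"
  assumes "continuous_on {a..b} f"
  shows "continuous_on J (\<lambda>x. f (ereal x))"
  by (rule continuous_on_compose2[OF assms]) (auto intro!: continuous_intros simp: einterval_iff)

text \<open>The interval \<open>{a..b}\<close> of extended reals is compact even if its endpoints
  are infinite, so continuity up to the endpoints yields boundedness.\<close>

lemma bounded_J:
  fixes f :: "ereal \<Rightarrow> 'v::euclidean_space"
  assumes "continuous_on {a..b} f"
  shows "bounded ((\<lambda>x. f (ereal x)) ` J)"
proof -
  have "bounded (f ` {a..b})"
    by (intro compact_imp_bounded compact_continuous_image assms) (simp add: compact_eq_closed)
  then show ?thesis by (rule bounded_subset) (auto simp: einterval_iff intro!: imageI)
qed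

lemma measurable_J:
  fixes f :: "ereal \<Rightarrow> 'v::euclidean_space"
  assumes "continuous_on {a..b} f"
  shows "set_borel_measurable lebesgue J (\<lambda>x. f (ereal x))"
  by (intro set_borel_measurable_continuous_on continuous_on_J assms borel_einterval)

lemma U_mult_vec_diff:
  assumes "a \<le> x" "x \<le> y" "y \<le> b"
  shows "U y *v v - U x *v v = (LINT t:einterval x y|lebesgue. G t *v v)"
  using U_diff'[OF assms] set_integral_mult_vec(2)[OF set_integrable_einterval_subset[OF G_int, of x y], of v] assms
  by (simp add: matrix_vector_mult_diff_rdistrib[symmetric])

lemma U_ker_propagates:
  assumes "x \<in> {a..b}" "y \<in> {a..b}" "U x *v v = 0"
  shows "U y *v v = 0"
proof -
  have *: "U t *v v = 0" if xy: "x \<le> y" "x \<in> {a..b}" "y \<in> {a..b}" and "t \<in> {x..y}" and z: "U x *v v = 0 \<or> U y *v v = 0" for x y t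
  proof (rule linear_system_zero[where z="\<lambda>e. U e *v v" and x=x and y=y and M=M and G="\<lambda>t. G t *v v"])
    show "set_integrable lebesgue (einterval x y) M" "set_integrable lebesgue (einterval x y) (\<lambda>t. G t *v v)"
      using xy by (auto intro!: set_integrable_einterval_subset[OF M_int] set_integral_mult_vec set_integrable_einterval_subset[OF G_int])
    show "AE t\<in>einterval x y in lebesgue. G t *v v = M t *v (U (ereal t) *v v)"
      using G_eq
    proof eventually_elim
      case (elim t)
      have "einterval x y \<subseteq> J" using xy by (intro einterval_mono) auto
      then show ?case using elim by (auto simp: matrix_vector_mul_assoc)
    qed
    show "U t *v v - U s *v v = (LINT r:einterval s t|lebesgue. G r *v v)" if "x \<le> s" "s \<le> t" "t \<le> y" for s t
      using xy that by (intro U_mult_vec_diff) auto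
  qed fact+
  show ?thesis
  proof (cases "x \<le> y")
    case True
    then show ?thesis using *[of x y y] assms by auto
  next
    case False
    then show ?thesis using *[of y x y] assms by auto
  qed
qed

lemma invertible_iff_ker: "invertible (U x) \<longleftrightarrow> (\<forall>v. U x *v v = 0 \<longrightarrow> v = 0)"
  by (simp add: invertible_det_nz det_nonzero_iff_ker)

lemma U_invertible_iff:
  assumes "x \<in> {a..b}" "y \<in> {a..b}"
  shows "invertible (U x) \<longleftrightarrow> invertible (U y)"
  unfolding invertible_iff_ker using U_ker_propagates[of x y] U_ker_propagates[of y x] assms by blast

lemma U_locally_absolutely_continuous:
  "locally_absolutely_continuous_on J (\<lambda>x. U (ereal x))"
  "AE x\<in>J in lebesgue. ((\<lambda>x. U (ereal x)) has_vector_derivative G x) (at x)"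
  by (rule indefinite_integral_locally_absolutely_continuous[OF G_int]; rule U_diff'; auto simp: einterval_iff)+

lemma U_solution: "is_solution_on J \<alpha> (\<lambda>t. B t ** C t) (\<lambda>x. U (ereal x))"
  unfolding is_solution_on_def
proof
  show "AE x\<in>J in lebesgue. ((\<lambda>x. U (ereal x)) has_vector_derivative \<alpha> *\<^sub>c (B x ** C x ** U (ereal x))) (at x)"
    using U_locally_absolutely_continuous(2) G_eq
    by eventually_elim (auto simp: M_def cscale_matrix_mult)
qed (rule U_locally_absolutely_continuous)

text \<open>\<open>V\<close> is prescribed on \<open>J\<close> only. Absolute continuity on compact
  subintervals and derivatives at points of the open set \<open>J\<close> do not see other values,
  so both pass from \<open>U D\<close> to \<open>V\<close>.\<close>

lemma U_mult_solution:
  assumes V: "\<And>x. x \<in> J \<Longrightarrow> V x = U (ereal x) ** D"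
  shows "is_solution_on J \<alpha> (\<lambda>t. B t ** C t) V"
  unfolding is_solution_on_def
proof
  show "locally_absolutely_continuous_on J V"
    unfolding locally_absolutely_continuous_on_def
  proof (intro allI impI)
    fix c d assume cd: "{c..d} \<subseteq> J"
    have "absolutely_continuous_on_interval c d (\<lambda>x. U (ereal x))"
      using U_locally_absolutely_continuous(1) cd unfolding locally_absolutely_continuous_on_def by blast
    moreover have "absolutely_continuous_on_interval c d (\<lambda>x. D)"
      by (auto simp: absolutely_continuous_on_interval_def intro: exI[of _ 1])
    ultimately have "absolutely_continuous_on_interval c d (\<lambda>x. U (ereal x) ** D)"
      by (rule absolutely_continuous_on_interval_bilinear[OF bounded_bilinear_matrix_mult])
    then show "absolutely_continuous_on_interval c d V"
      using absolutely_continuous_on_interval_cong[of c d V "\<lambda>x. U (ereal x) ** D"] V cd by blast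
  qed
  show "AE x\<in>J in lebesgue. (V has_vector_derivative \<alpha> *\<^sub>c (B x ** C x ** V x)) (at x)"
    using U_locally_absolutely_continuous(2) G_eq
  proof eventually_elim
    case (elim x)
    show ?case
    proof
      assume x: "x \<in> J"
      have "((\<lambda>x. U (ereal x)) has_vector_derivative G x) (at x)" using elim x by blast
      from bounded_linear.has_vector_derivative[OF bounded_bilinear.bounded_linear_left[OF bounded_bilinear_matrix_mult] this, of D]
      have "((\<lambda>x. U (ereal x) ** D) has_vector_derivative G x ** D) (at x)" .
      then have "(V has_vector_derivative G x ** D) (at x)"
        by (rule has_vector_derivative_transform_within_open[OF _ open_einterval x]) (simp add: V)
      moreover have "G x ** D = \<alpha> *\<^sub>c (B x ** C x ** V x)"
        using elim x V by (simp add: M_def cscale_matrix_mult matrix_mul_assoc)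
      ultimately show "(V has_vector_derivative \<alpha> *\<^sub>c (B x ** C x ** V x)) (at x)" by simp
    qed
  qed
qed

text \<open>Confined to interior points, since an arbitrary solution is not yet known to extend to
  \<open>a\<close> and \<open>b\<close>. On a compact subinterval it is bounded, so
  \<open>M V\<close> inherits integrability from \<open>M\<close>.\<close>

lemma solution_diff:
  assumes V: "is_solution_on J \<alpha> (\<lambda>t. B t ** C t) V" and cd: "c \<le> d" "c \<in> J" "d \<in> J"
  shows "set_integrable lebesgue {c<..<d} (\<lambda>t. M t ** V t)"
    and "V d - V c = (LINT t:{c<..<d}|lebesgue. M t ** V t)"
proof -
  have sub: "{c..d} \<subseteq> J"
    using cd(2,3) by (rule Icc_subset_einterval)
  have ac: "absolutely_continuous_on_interval c d V"
    using V sub by (simp add: is_solution_on_def locally_absolutely_continuous_on_def)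
  have cont: "continuous_on {c..d} V" by (rule absolutely_continuous_on_interval_imp_continuous_on[OF ac])
  have int: "set_integrable lebesgue {c..d} (\<lambda>t. M t ** V t)"
  proof (rule set_integrable_bilinear_bounded[OF bounded_bilinear_matrix_mult])
    show "set_integrable lebesgue {c..d} M" by (rule set_integrable_subset[OF M_int _ sub]) simp
    show "set_borel_measurable lebesgue {c..d} V" by (rule set_borel_measurable_continuous_on[OF _ cont]) simp
    show "bounded (V ` {c..d})" by (intro compact_imp_bounded compact_continuous_image cont compact_Icc)
  qed
  then show "set_integrable lebesgue {c<..<d} (\<lambda>t. M t ** V t)" by (rule set_integrable_subset) auto
  have "AE x\<in>J in lebesgue. (V has_vector_derivative \<alpha> *\<^sub>c (B x ** C x ** V x)) (at x)"
    using V by (simp add: is_solution_on_def)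
  then have "AE x\<in>{c..d} in lebesgue. (V has_vector_derivative M x ** V x) (at x)"
    by eventually_elim (use sub in \<open>auto simp: M_def cscale_matrix_mult\<close>)
  from set_integral_absolutely_continuous[OF cd(1) ac this int]
  show "V d - V c = (LINT t:{c<..<d}|lebesgue. M t ** V t)" by simp
qed

text \<open>Applied to a fixed vector, the difference of the two solutions satisfies the linear
  system between \<open>x0\<close> and \<open>x\<close> and vanishes at one end of that
  interval.\<close>

lemma solution_unique:
  assumes V: "is_solution_on J \<alpha> (\<lambda>t. B t ** C t) V" and W: "is_solution_on J \<alpha> (\<lambda>t. B t ** C t) W"
    and x0: "x0 \<in> J" "V x0 = W x0" and x: "x \<in> J"
  shows "V x = W x"
proof -
  define c d where "c = min x x0" and "d = max x x0"
  have cd: "c \<le> d" "c \<in> J" "d \<in> J" using x x0 by (auto simp: c_def d_def min_def max_def)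
  have "(V x - W x) *v v = 0" for v
  proof -
    \<comment> \<open>Uniqueness is phrased for functions of an extended real; between
      \<open>c\<close> and \<open>d\<close> every point is finite, so the conversion is
      harmless.\<close>
    define z where "z = (\<lambda>e. (V (real_of_ereal e) - W (real_of_ereal e)) *v v)"
    define R where "R = (\<lambda>t. (M t ** V t - M t ** W t) *v v)"
    have "z (ereal x) = 0"
    proof (rule linear_system_zero[where z=z and x="ereal c" and y="ereal d" and M=M and G=R])
      show "set_integrable lebesgue (einterval c d) M"
        using cd by (intro set_integrable_einterval_subset[OF M_int]) (auto simp: J_D)
      have int: "set_integrable lebesgue (einterval s t) R"
         "(LINT r:einterval s t|lebesgue. R r) = (V t - W t) *v v - (V s - W s) *v v"
         if st: "s \<le> t" "s \<in> J" "t \<in> J" for s t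
      proof -
        note d = solution_diff[OF V st] solution_diff[OF W st]
        have i: "set_integrable lebesgue (einterval s t) (\<lambda>r. M r ** V r - M r ** W r)"
          using d by (auto intro: set_integral_diff)
        show "set_integrable lebesgue (einterval s t) R"
          unfolding R_def by (rule set_integral_mult_vec[OF i])
        have "(LINT r:einterval s t|lebesgue. R r) = ((V t - V s) - (W t - W s)) *v v"
          unfolding R_def set_integral_mult_vec(2)[OF i] using d by simp
        also have "\<dots> = (V t - W t) *v v - (V s - W s) *v v"
          by (simp add: algebra_simps)
        finally show "(LINT r:einterval s t|lebesgue. R r) = (V t - W t) *v v - (V s - W s) *v v" .
      qed
      show "set_integrable lebesgue (einterval c d) R" using int(1) cd by blast
      show "AE t\<in>einterval c d in lebesgue. R t = M t *v z (ereal t)"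
        by (intro AE_I2 impI) (simp add: R_def z_def matrix_vector_mul_assoc bounded_bilinear.diff_right[OF bounded_bilinear_matrix_mult])
      show "z t - z s = (LINT r:einterval s t|lebesgue. R r)" if "ereal c \<le> s" "s \<le> t" "t \<le> ereal d" for s t
      proof -
        have "ereal c \<le> s" "s \<le> ereal d" "ereal c \<le> t" "t \<le> ereal d"
          using that by (auto intro: order_trans)
        then obtain s' t' where st: "s = ereal s'" "t = ereal t'" using that by (cases s; cases t) auto
        then have "s' \<in> {c..d}" "t' \<in> {c..d}"
          using \<open>ereal c \<le> s\<close> \<open>s \<le> ereal d\<close> \<open>ereal c \<le> t\<close> \<open>t \<le> ereal d\<close> by auto
        then have "s' \<in> J" "t' \<in> J" using Icc_subset_einterval[OF cd(2,3)] by auto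
        then show ?thesis using int(2)[of s' t'] that st by (simp add: z_def)
      qed
      show "z (ereal c) = 0 \<or> z (ereal d) = 0" using x0 by (auto simp: z_def c_def d_def min_def max_def)
      show "ereal x \<in> {ereal c..ereal d}" by (auto simp: c_def d_def)
    qed
    then show ?thesis by (simp add: z_def)
  qed
  then have "V x - W x = 0" by (simp add: matrix_eq)
  then show ?thesis by simp
qed

end

locale nonsingular_fundamental_matrix = fundamental_matrix a b \<alpha> B C F U P0
  for a b :: ereal and \<alpha> :: complex
    and B :: "real \<Rightarrow> complex ^ 'm ^ 'n" and C :: "real \<Rightarrow> complex ^ 'n ^ 'm"
    and F :: "real \<Rightarrow> complex ^ 'n ^ 'm"
    and U :: "ereal \<Rightarrow> complex ^ 'n ^ 'n" and P0 :: "complex ^ 'n ^ 'n" +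
  assumes U_a_invertible: "invertible (U a)"
begin

lemma U_invertible: "x \<in> {a..b} \<Longrightarrow> invertible (U x)"
  using U_invertible_iff[of x a] U_a_invertible ab by auto

lemma U_inv: "x \<in> {a..b} \<Longrightarrow> U x ** matrix_inv (U x) = mat 1"
  by (rule invertible_matrix_inv(1)[OF U_invertible])

lemma U_inv_cont: "continuous_on {a..b} (\<lambda>x. matrix_inv (U x))"
  by (rule continuous_on_matrix_inv[OF U_cont U_invertible])

lemma general_solution:
  "is_solution_on J \<alpha> (\<lambda>t. B t ** C t) V \<longleftrightarrow> (\<exists>D. \<forall>x\<in>J. V x = U (ereal x) ** D)"
proof
  assume V: "is_solution_on J \<alpha> (\<lambda>t. B t ** C t) V"
  obtain x0 where x0: "x0 \<in> J" using einterval_nonempty[OF ab] by blast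
  define D where "D = matrix_inv (U (ereal x0)) ** V x0"
  have "U (ereal x0) ** D = V x0"
    using U_inv[of "ereal x0"] x0 by (simp add: D_def matrix_mul_assoc J_D)
  then have "V x = U (ereal x) ** D" if "x \<in> J" for x
    using solution_unique[OF V U_mult_solution[of "\<lambda>x. U (ereal x) ** D" D] x0] that by simp
  then show "\<exists>D. \<forall>x\<in>J. V x = U (ereal x) ** D" by blast
qed (use U_mult_solution in blast)

section \<open>Boundary conditions at the two endpoints and the projection \<open>P0\<close>\<close>

lemma U_mult_eq_zeroD: "U x *v v = 0 \<Longrightarrow> x \<in> {a..b} \<Longrightarrow> v = 0"
  using U_invertible invertible_iff_ker by blast

lemma U_a_mult_vec: "U a *v (P0 *v v) = P0 *v v"
  by (simp add: matrix_vector_mul_assoc U_a)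

lemma U_b_mult_vec: "U b *v ((mat 1 - P0) *v v) = (mat 1 - P0) *v v"
  by (simp add: matrix_vector_mul_assoc U_b)

lemma P0_mult_vec: "P0 *v (P0 *v v) = P0 *v v" "P0 *v ((mat 1 - P0) *v v) = 0"
  by (simp_all add: matrix_vector_mul_assoc P0_idem matrix_vector_mult_diff_rdistrib matrix_vector_mult_diff_distrib)

text \<open>\<open>U a\<close> fixes the range of \<open>P0\<close> and \<open>U b\<close> fixes the
  range of \<open>1 - P0\<close>. Hence \<open>U a\<close> fixes \<open>U a d\<close>, and
  injectivity gives \<open>U a d = d\<close>; in the same way \<open>U b d = d\<close>. The two
  conditions now read \<open>P0 d = d\<close> and \<open>P0 d = 0\<close>.\<close>

lemma boundary_conditions_zero:
  assumes b0: "P0 *v (U b *v d) = 0" and a0: "P0 *v (U a *v d) = U a *v d"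
  shows "d = 0"
proof -
  have "U a *v (U a *v d) = U a *v (P0 *v (U a *v d))" by (simp add: a0)
  also have "\<dots> = P0 *v (U a *v d)" by (rule U_a_mult_vec)
  finally have "U a *v (U a *v d - d) = 0" by (simp add: a0 algebra_simps)
  then have 1: "U a *v d = d" using U_mult_eq_zeroD[of a "U a *v d - d"] ab by simp
  have "U b *v (U b *v d) = U b *v ((mat 1 - P0) *v (U b *v d))" using b0 by (simp add: algebra_simps)
  also have "\<dots> = (mat 1 - P0) *v (U b *v d)" by (rule U_b_mult_vec)
  finally have "U b *v (U b *v d - d) = 0" using b0 by (simp add: algebra_simps)
  then have "U b *v d = d" using U_mult_eq_zeroD[of b "U b *v d - d"] ab by simp
  then show ?thesis using 1 a0 b0 by simp
qed

text \<open>Multiplication by \<open>P0\<close> from the left reproduces one side of the equation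
  and annihilates the other, so both sides vanish. The same holds with \<open>P0\<close> for
  \<open>P\<close>, hence \<open>(P - P0) v\<close> satisfies the homogeneous boundary conditions
  for every \<open>v\<close>.\<close>

lemma boundary_projection_unique:
  "P0 ** U b ** (mat 1 - P) = (mat 1 - P0) ** U a ** P \<longleftrightarrow> P = P0"
proof -
  have z: "P0 *v (U b *v ((mat 1 - P0) *v v)) = 0" "P0 *v (U a *v (P0 *v v)) = U a *v (P0 *v v)" for v
    by (simp_all only: U_a_mult_vec U_b_mult_vec P0_mult_vec)
  show ?thesis
  proof
    assume eq: "P0 ** U b ** (mat 1 - P) = (mat 1 - P0) ** U a ** P"
    have eqv: "P0 *v (U b *v ((mat 1 - P) *v v)) = (mat 1 - P0) *v (U a *v (P *v v))" for v
      using arg_cong[OF eq, of "\<lambda>X. X *v v"] by (simp only: matrix_vector_mul_assoc[symmetric])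
    have l0: "P0 *v (U b *v ((mat 1 - P) *v v)) = 0" for v
    proof -
      have "P0 *v (P0 *v (U b *v ((mat 1 - P) *v v))) = P0 *v ((mat 1 - P0) *v (U a *v (P *v v)))"
        by (simp only: eqv)
      then show ?thesis by (simp only: P0_mult_vec)
    qed
    have r0: "P0 *v (U a *v (P *v v)) = U a *v (P *v v)" for v
      using l0[of v] eqv[of v] by (simp add: algebra_simps)
    have "P *v v = P0 *v v" for v
    proof -
      have "P *v v - P0 *v v = 0"
      proof (rule boundary_conditions_zero)
        \<comment> \<open>The facts available at \<open>b\<close> concern \<open>1 - P\<close> and
          \<open>1 - P0\<close>, so the difference is expressed by these.\<close>
        have "P *v v - P0 *v v = (mat 1 - P0) *v v - (mat 1 - P) *v v" by (simp add: algebra_simps)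
        then show "P0 *v (U b *v (P *v v - P0 *v v)) = 0"
          using l0[of v] z(1)[of v] by (simp only: matrix_vector_mult_diff_distrib) simp
        show "P0 *v (U a *v (P *v v - P0 *v v)) = U a *v (P *v v - P0 *v v)"
          by (simp only: matrix_vector_mult_diff_distrib r0 z(2))
      qed
      then show ?thesis by simp
    qed
    then show "P = P0" by (simp add: matrix_eq)
  next
    assume P: "P = P0"
    show "P0 ** U b ** (mat 1 - P) = (mat 1 - P0) ** U a ** P"
      unfolding P matrix_eq matrix_vector_mul_assoc[symmetric] z
      by (simp add: z matrix_vector_mult_diff_rdistrib)
  qed
qed

section \<open>The operators 1 - \<alpha> K and 1 + \<alpha> L on square-integrable
  functions\<close>

lemma B_mult_int: "L2_on J \<phi> \<Longrightarrow> set_integrable lebesgue J (\<lambda>y. B y *v \<phi> y)"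
  by (rule set_integrable_L2_prod[OF bounded_bilinear_matrix_vector_mult B_L2])

lemma C_mult_L2: "continuous_on {a..b} z \<Longrightarrow> L2_on J (\<lambda>x. C x *v z (ereal x))"
  by (rule L2_on_bilinear_bounded[OF bounded_bilinear_matrix_vector_mult C_L2 measurable_J bounded_J einterval_lebesgue])

text \<open>The locale knows no blocks, so \<open>K\<close> appears as the \<open>L_kernel\<close>
  operator of the constant matrix 1; the two forms are identified once \<open>B\<close> and
  \<open>C\<close> have their block structure.\<close>

definition one_minus_K where
  "one_minus_K \<phi> x = \<phi> x - \<alpha> *s integral_operator J (L_kernel C B (\<lambda>_. mat 1) P0) \<phi> x"
definition one_plus_L where
  "one_plus_L \<phi> x = \<phi> x + \<alpha> *s integral_operator J (L_kernel C B (\<lambda>x. U (ereal x)) P0) \<phi> x"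

abbreviation SP where "SP \<equiv> split_primitive a b P0"

definition Uinv_B where "Uinv_B \<phi> = (\<lambda>y. matrix_inv (U (ereal y)) *v (B y *v \<phi> y))"

lemma Uinv_B_int: "L2_on J \<phi> \<Longrightarrow> set_integrable lebesgue J (Uinv_B \<phi>)"
  unfolding Uinv_B_def
  by (rule set_integrable_bilinear_bounded[OF bounded_bilinear.flip[OF bounded_bilinear_matrix_vector_mult]
        B_mult_int measurable_J[OF U_inv_cont] bounded_J[OF U_inv_cont]])

lemma one_minus_K_eq:
  assumes "L2_on J \<phi>" "x \<in> J"
  shows "one_minus_K \<phi> x = \<phi> x - \<alpha> *s (C x *v SP (\<lambda>y. B y *v \<phi> y) (ereal x))"
  using integral_operator_L_kernel[where W="\<lambda>_. mat 1" and B=B and C=C and P=P0 and \<phi>=\<phi> and x=x] B_mult_int[OF assms(1)] assms(2)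
  by (simp add: one_minus_K_def matrix_inv_mat_1)

lemma one_plus_L_eq:
  assumes "L2_on J \<phi>" "x \<in> J"
  shows "one_plus_L \<phi> x = \<phi> x + \<alpha> *s (C x *v (U (ereal x) *v SP (Uinv_B \<phi>) (ereal x)))"
  using integral_operator_L_kernel[where W="\<lambda>x. U (ereal x)" and B=B and C=C and P=P0 and \<phi>=\<phi> and x=x]
    Uinv_B_int[OF assms(1)] assms(2)
  by (simp add: one_plus_L_def Uinv_B_def)

lemma SP_cont: "set_integrable lebesgue J h \<Longrightarrow> continuous_on {a..b} (SP h)"
  by (rule continuous_on_split_primitive) (use ab in auto)

lemma U_SP_cont: "set_integrable lebesgue J h \<Longrightarrow> continuous_on {a..b} (\<lambda>e. U e *v SP h e)"
  by (rule bounded_bilinear.continuous_on[OF bounded_bilinear_matrix_vector_mult U_cont SP_cont])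

text \<open>Both operators differ from the identity by a multiple of \<open>C z\<close> with
  \<open>z\<close> continuous up to the endpoints, hence bounded. Square integrability thus follows
  from that of \<open>C\<close>, without an estimate of the kernels.\<close>

lemma L2_on_perturb:
  assumes \<phi>: "L2_on J \<phi>" and z: "continuous_on {a..b} z"
    and eq: "\<And>x. x \<in> J \<Longrightarrow> \<psi> x = \<phi> x + c *s (C x *v z (ereal x))"
  shows "L2_on J \<psi>"
proof -
  have "L2_on J (\<lambda>x. \<phi> x + c *s (C x *v z (ereal x)))"
    by (rule L2_on_add[OF \<phi> L2_on_bounded_linear[OF bounded_linear_vector_scalar_mult C_mult_L2[OF z] einterval_lebesgue]])
  then show ?thesis
    using L2_on_cong[of J \<psi> "\<lambda>x. \<phi> x + c *s (C x *v z (ereal x))"] eq by simp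
qed

lemma one_minus_K_L2:
  assumes \<phi>: "L2_on J \<phi>"
  shows "L2_on J (one_minus_K \<phi>)"
proof (rule L2_on_perturb[OF \<phi> SP_cont[OF B_mult_int[OF \<phi>]]])
  have neg: "(- \<alpha>) *s v = - (\<alpha> *s v)" for v :: "complex ^ 'm" by (simp add: vec_eq_iff)
  show "one_minus_K \<phi> x = \<phi> x + (- \<alpha>) *s (C x *v SP (\<lambda>y. B y *v \<phi> y) (ereal x))" if "x \<in> J" for x
    using one_minus_K_eq[OF \<phi> that] by (simp add: neg)
qed

lemma one_plus_L_L2:
  assumes \<phi>: "L2_on J \<phi>"
  shows "L2_on J (one_plus_L \<phi>)"
  by (rule L2_on_perturb[OF \<phi> U_SP_cont[OF Uinv_B_int[OF \<phi>]]]) (rule one_plus_L_eq[OF \<phi>])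

text \<open>Variation of constants: for the primitive \<open>w\<close> of
  \<open>U\<^sup>-\<^sup>1 B \<phi>\<close>, the product rule gives \<open>(U w)' = B \<phi> +
  \<alpha> B C U w = B (1 + \<alpha> L) \<phi>\<close> almost everywhere. The product is absolutely
  continuous, so this integrates over compact subintervals of \<open>J\<close>.\<close>

lemma U_SP_diff:
  assumes \<phi>: "L2_on J \<phi>" and xy: "a \<le> x" "x \<le> y" "y \<le> b"
  shows "U y *v SP (Uinv_B \<phi>) y - U x *v SP (Uinv_B \<phi>) x = (LINT t:einterval x y|lebesgue. B t *v one_plus_L \<phi> t)"
proof -
  define h where "h = Uinv_B \<phi>"
  define z where "z = (\<lambda>e. U e *v SP h e)"
  have h: "set_integrable lebesgue J h" unfolding h_def by (rule Uinv_B_int[OF \<phi>])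
  have BT: "set_integrable lebesgue J (\<lambda>t. B t *v one_plus_L \<phi> t)" by (rule B_mult_int[OF one_plus_L_L2[OF \<phi>]])
  have SPd: "SP h (ereal y) - SP h (ereal x) = (LINT t:einterval x y|lebesgue. h t)" if "x \<in> J" "y \<in> J" "x \<le> y" for x y
    using that by (intro split_primitive_diff[OF h]) (auto simp: J_D)
  have w: "locally_absolutely_continuous_on J (\<lambda>x. SP h (ereal x))"
    "AE x\<in>J in lebesgue. ((\<lambda>x. SP h (ereal x)) has_vector_derivative h x) (at x)"
    by (rule indefinite_integral_locally_absolutely_continuous[OF h]; rule SPd; assumption)+
  have der: "AE x\<in>J in lebesgue. ((\<lambda>x. z (ereal x)) has_vector_derivative B x *v one_plus_L \<phi> x) (at x)"
    using w(2) U_locally_absolutely_continuous(2) G_eq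
  proof eventually_elim
    case (elim x)
    show ?case
    proof
      assume x: "x \<in> J"
      have "((\<lambda>x. z (ereal x)) has_vector_derivative U (ereal x) *v h x + G x *v SP h (ereal x)) (at x)"
        unfolding z_def
        by (rule bounded_bilinear.has_vector_derivative[OF bounded_bilinear_matrix_vector_mult]) (use elim x in auto)
      moreover have "U (ereal x) *v h x = B x *v \<phi> x"
        using x by (simp add: h_def Uinv_B_def matrix_vector_mul_assoc matrix_mul_assoc U_inv J_D)
      moreover have "G x *v SP h (ereal x) = B x *v (\<alpha> *s (C x *v z (ereal x)))"
        using elim x by (simp add: M_def z_def cscale_matrix_mult cscale_matrix_vector_mult matrix_vector_mul_assoc matrix_mul_assoc)
      ultimately show "((\<lambda>x. z (ereal x)) has_vector_derivative B x *v one_plus_L \<phi> x) (at x)"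
        using one_plus_L_eq[OF \<phi> x] by (simp add: z_def h_def matrix_vector_right_distrib)
    qed
  qed
  have interior: "z (ereal d) - z (ereal c) = (LINT t:einterval c d|lebesgue. B t *v one_plus_L \<phi> t)" if cd: "c \<le> d" "c \<in> J" "d \<in> J" for c d
  proof -
    have sub: "{c..d} \<subseteq> J"
      using cd(2,3) by (rule Icc_subset_einterval)
    have "absolutely_continuous_on_interval c d (\<lambda>x. z (ereal x))"
      unfolding z_def using U_locally_absolutely_continuous(1) w(1) sub
      by (intro absolutely_continuous_on_interval_bilinear[OF bounded_bilinear_matrix_vector_mult])
        (auto simp: locally_absolutely_continuous_on_def)
    moreover have "AE x\<in>{c..d} in lebesgue. ((\<lambda>x. z (ereal x)) has_vector_derivative B x *v one_plus_L \<phi> x) (at x)"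
      using der by eventually_elim (use sub in auto)
    moreover have "set_integrable lebesgue {c..d} (\<lambda>t. B t *v one_plus_L \<phi> t)"
      by (rule set_integrable_subset[OF BT _ sub]) simp
    ultimately show ?thesis
      using set_integral_absolutely_continuous[OF cd(1), of "\<lambda>x. z (ereal x)" "\<lambda>t. B t *v one_plus_L \<phi> t"] by simp
  qed
  \<comment> \<open>Constancy of \<open>R\<close> inside \<open>J\<close> together with its
    continuity on \<open>{a..b}\<close> extends the identity to the endpoints, where no derivative
    is available.\<close>
  define R where "R = (\<lambda>e. z e - (LINT t:einterval a e|lebesgue. B t *v one_plus_L \<phi> t))"
  obtain x0 where x0: "x0 \<in> J" using einterval_nonempty[OF ab] by blast
  have comb: "(LINT t:einterval a y|lebesgue. B t *v one_plus_L \<phi> t)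
      = (LINT t:einterval a x|lebesgue. B t *v one_plus_L \<phi> t) + (LINT t:einterval x y|lebesgue. B t *v one_plus_L \<phi> t)" if "a \<le> x" "x \<le> y" "y \<le> b" for x y
    using that by (intro set_integral_einterval_combine set_integrable_einterval_subset[OF BT]) auto
  have mono: "R (ereal d) = R (ereal c)" if cd: "c \<le> d" "c \<in> J" "d \<in> J" for c d
    using interior[OF cd] comb[of "ereal c" "ereal d"] cd by (simp add: R_def J_D algebra_simps)
  have const: "R e = R (ereal x0)" if "e \<in> {a..b}" for e
  proof (rule continuous_on_ereal_const_closure[OF ab _ _ that])
    show "continuous_on {a..b} R" unfolding R_def z_def
      by (intro continuous_on_diff U_SP_cont[OF h] continuous_on_set_integral_einterval BT)
    show "R (ereal x) = R (ereal x0)" if "x \<in> J" for x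
      using mono[of x x0] mono[of x0 x] x0 that by (cases "x \<le> x0") auto
  qed
  have "R y = R x" using const[of x] const[of y] xy by auto
  then show ?thesis using comb[OF xy] by (simp add: R_def z_def h_def algebra_simps)
qed

text \<open>For \<open>\<psi> = (1 + \<alpha> L) \<phi>\<close> equality of the primitives means
  \<open>K \<psi> = L \<phi>\<close>, so \<open>\<psi> - \<alpha> K \<psi> = \<phi>\<close>. The
  boundary conditions pass from \<open>w\<close> to \<open>U w\<close> because \<open>U a\<close>
  fixes the range of \<open>P0\<close> and \<open>U b\<close> that of \<open>1 - P0\<close>.\<close>

lemma one_minus_K_one_plus_L:
  assumes \<phi>: "L2_on J \<phi>" and x: "x \<in> J"
  shows "one_minus_K (one_plus_L \<phi>) x = \<phi> x"
proof -
  have "U (ereal x) *v SP (Uinv_B \<phi>) (ereal x) = SP (\<lambda>y. B y *v one_plus_L \<phi> y) (ereal x)"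
  proof (rule split_primitive_unique[where z="\<lambda>e. U e *v SP (Uinv_B \<phi>) e"])
    have "P0 *v SP (Uinv_B \<phi>) a = SP (Uinv_B \<phi>) a" by (rule split_primitive_left[OF P0_idem])
    then have "U a *v SP (Uinv_B \<phi>) a = P0 *v SP (Uinv_B \<phi>) a"
      by (metis matrix_vector_mul_assoc U_a)
    then show "P0 *v (U a *v SP (Uinv_B \<phi>) a) = U a *v SP (Uinv_B \<phi>) a"
      by (simp add: matrix_vector_mul_assoc P0_idem)
    have "P0 *v SP (Uinv_B \<phi>) b = 0" by (rule split_primitive_right[OF P0_idem])
    then have e: "(mat 1 - P0) *v SP (Uinv_B \<phi>) b = SP (Uinv_B \<phi>) b" by (simp add: algebra_simps)
    then have "U b *v SP (Uinv_B \<phi>) b = (mat 1 - P0) *v SP (Uinv_B \<phi>) b"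
      by (metis matrix_vector_mul_assoc U_b)
    then show "P0 *v (U b *v SP (Uinv_B \<phi>) b) = 0"
      using e split_primitive_right[OF P0_idem] by simp
  qed (use U_SP_diff[OF \<phi>] x in \<open>auto simp: J_D\<close>)
  then show ?thesis using one_minus_K_eq[OF one_plus_L_L2[OF \<phi>] x] one_plus_L_eq[OF \<phi> x] by simp
qed

text \<open>Almost everywhere \<open>\<eta> = \<alpha> C z\<close>, hence
  \<open>B \<eta> = M z\<close>. Thus \<open>z\<close> satisfies the same integrated system as the
  columns of \<open>U\<close>, up to both endpoints, and inherits its boundary conditions from the
  split primitive.\<close>

lemma one_minus_K_injective:
  assumes \<eta>: "L2_on J \<eta>" and S0: "AE x\<in>J in lebesgue. one_minus_K \<eta> x = 0"
  shows "AE x\<in>J in lebesgue. \<eta> x = 0"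
proof -
  define z where "z = SP (\<lambda>y. B y *v \<eta> y)"
  have B\<eta>: "set_integrable lebesgue J (\<lambda>y. B y *v \<eta> y)" by (rule B_mult_int[OF \<eta>])
  have z_diff: "z y - z x = (LINT t:einterval x y|lebesgue. B t *v \<eta> t)" if "a \<le> x" "x \<le> y" "y \<le> b" for x y
    unfolding z_def using that by (rule split_primitive_diff[OF B\<eta>])
  have \<eta>_eq: "AE x\<in>J in lebesgue. \<eta> x = \<alpha> *s (C x *v z (ereal x))"
    using S0 by eventually_elim (auto simp: one_minus_K_eq[OF \<eta>] z_def)
  \<comment> \<open>Chosen so that \<open>U d\<close> and \<open>z\<close> agree at
    \<open>a\<close>, which is the zero that uniqueness starts from.\<close>
  define d where "d = matrix_inv (U a) *v z a"
  have Ud: "U a *v d = z a" using U_inv[of a] ab by (simp add: d_def matrix_vector_mul_assoc)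
  have zU: "z e - U e *v d = 0" if e: "e \<in> {a..b}" for e
  proof (rule linear_system_zero[where x=a and y=b and M=M and G="\<lambda>t. B t *v \<eta> t - G t *v d" and z="\<lambda>e. z e - U e *v d"])
    have Gd: "set_integrable lebesgue J (\<lambda>t. G t *v d)" by (rule set_integral_mult_vec[OF G_int])
    show "set_integrable lebesgue J M" by (rule M_int)
    show "set_integrable lebesgue J (\<lambda>t. B t *v \<eta> t - G t *v d)"
      by (rule set_integral_diff(1)[OF B\<eta> Gd])
    show "AE t\<in>J in lebesgue. B t *v \<eta> t - G t *v d = M t *v (z (ereal t) - U (ereal t) *v d)"
      using \<eta>_eq G_eq
      by eventually_elim (auto simp: M_def cscale_matrix_vector_mult matrix_vector_mult_diff_distrib matrix_vector_mul_assoc)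
    show "z t - U t *v d - (z s - U s *v d) = (LINT r:einterval s t|lebesgue. B r *v \<eta> r - G r *v d)"
      if st: "a \<le> s" "s \<le> t" "t \<le> b" for s t
    proof -
      have "(LINT r:einterval s t|lebesgue. B r *v \<eta> r - G r *v d)
        = (LINT r:einterval s t|lebesgue. B r *v \<eta> r) - (LINT r:einterval s t|lebesgue. G r *v d)"
        using st by (intro set_integral_diff(2) set_integrable_einterval_subset[OF B\<eta>] set_integrable_einterval_subset[OF Gd])
      then show ?thesis
        unfolding z_diff[OF st, symmetric] U_mult_vec_diff[OF st, symmetric] by simp
    qed
  qed (use Ud e in auto)
  have "d = 0"
  proof (rule boundary_conditions_zero)
    have "U b *v d = z b" using zU[of b] ab by simp
    then show "P0 *v (U b *v d) = 0" by (simp add: z_def split_primitive_right[OF P0_idem])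
    show "P0 *v (U a *v d) = U a *v d" unfolding Ud by (simp add: z_def split_primitive_left[OF P0_idem])
  qed
  then have "z (ereal x) = 0" if "x \<in> J" for x
    using zU[of "ereal x"] that by (simp add: J_D)
  then show ?thesis using \<eta>_eq by auto
qed

text \<open>The instance of linearity by which injectivity makes the right inverse
  two-sided.\<close>

lemma one_minus_K_diff:
  assumes "L2_on J \<phi>" "L2_on J \<psi>" "x \<in> J"
  shows "one_minus_K (\<lambda>x. \<phi> x - \<psi> x) x = one_minus_K \<phi> x - one_minus_K \<psi> x"
proof -
  have L: "L2_on J (\<lambda>x. \<phi> x - \<psi> x)"
    using L2_on_add[OF assms(1) L2_on_bounded_linear[OF bounded_linear_minus[OF bounded_linear_ident] assms(2)]] by simp
  have i: "set_integrable lebesgue (einterval s t) (\<lambda>y. B y *v \<phi> y)" "set_integrable lebesgue (einterval s t) (\<lambda>y. B y *v \<psi> y)"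
    if "a \<le> s" "t \<le> b" for s t
    using that B_mult_int assms by (auto intro: set_integrable_einterval_subset)
  have "SP (\<lambda>y. B y *v (\<phi> y - \<psi> y)) (ereal x) = SP (\<lambda>y. B y *v \<phi> y) (ereal x) - SP (\<lambda>y. B y *v \<psi> y) (ereal x)"
    using i[of a x] i[of x b] J_D[OF assms(3)]
    by (simp add: split_primitive_def matrix_vector_mult_diff_distrib matrix_vector_mult_diff_rdistrib)
  then have "one_minus_K (\<lambda>x. \<phi> x - \<psi> x) x = \<phi> x - \<psi> x
      - \<alpha> *s (C x *v (SP (\<lambda>y. B y *v \<phi> y) (ereal x) - SP (\<lambda>y. B y *v \<psi> y) (ereal x)))"
    by (simp only: one_minus_K_eq[OF L assms(3)])
  then show ?thesis
    by (simp add: one_minus_K_eq[OF assms(1,3)] one_minus_K_eq[OF assms(2,3)] matrix_vector_mult_diff_distrib vec_eq_iff algebra_simps)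
qed

text \<open>Write \<open>S\<close> and \<open>T\<close> for the two operators. From
  \<open>S T = 1\<close> it follows that \<open>S (T S \<phi> - \<phi>) = 0\<close>, and injectivity
  of \<open>S\<close> gives \<open>T S \<phi> = \<phi>\<close> almost everywhere.\<close>

lemma operators_inverse: "L2_inverse_operators J one_minus_K one_plus_L"
  unfolding L2_inverse_operators_def
proof (intro allI impI conjI)
  fix \<phi> :: "real \<Rightarrow> complex ^ 'm" assume \<phi>: "L2_on J \<phi>"
  show "L2_on J (one_minus_K \<phi>)" "L2_on J (one_plus_L \<phi>)" by (rule one_minus_K_L2[OF \<phi>] one_plus_L_L2[OF \<phi>])+
  show "AE x\<in>J in lebesgue. one_minus_K (one_plus_L \<phi>) x = \<phi> x" using one_minus_K_one_plus_L[OF \<phi>] by auto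
  have TS: "L2_on J (one_plus_L (one_minus_K \<phi>))" by (rule one_plus_L_L2[OF one_minus_K_L2[OF \<phi>]])
  have "AE x\<in>J in lebesgue. one_plus_L (one_minus_K \<phi>) x - \<phi> x = 0"
  proof (rule one_minus_K_injective)
    show "L2_on J (\<lambda>x. one_plus_L (one_minus_K \<phi>) x - \<phi> x)"
      using L2_on_add[OF TS L2_on_bounded_linear[OF bounded_linear_minus[OF bounded_linear_ident] \<phi>]] by simp
    show "AE x\<in>J in lebesgue. one_minus_K (\<lambda>x. one_plus_L (one_minus_K \<phi>) x - \<phi> x) x = 0"
      using one_minus_K_diff[OF TS \<phi>] one_minus_K_one_plus_L[OF one_minus_K_L2[OF \<phi>]] by auto
  qed
  then show "AE x\<in>J in lebesgue. one_plus_L (one_minus_K \<phi>) x = \<phi> x" by simp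
qed

end

section \<open>Block matrices\<close>

lemma sum_UNIV_sum:
  fixes f :: "'p::finite + 'q::finite \<Rightarrow> 'a::comm_monoid_add"
  shows "(\<Sum>k\<in>UNIV. f k) = (\<Sum>k\<in>UNIV. f (Inl k)) + (\<Sum>k\<in>UNIV. f (Inr k))"
  unfolding UNIV_Plus_UNIV[symmetric] by (subst sum.Plus) auto

lemma block_nth [simp]:
  "row_block M N $ i $ Inl l = M $ i $ l" "row_block M N $ i $ Inr r = N $ i $ r"
  "col_block P Q $ Inl l' = P $ l'" "col_block P Q $ Inr r' = Q $ r'"
  by (simp_all add: row_block_def col_block_def)

lemma block_matrix_nth [simp]:
  "block_matrix A B C D $ Inl i $ Inl j = A $ i $ j" "block_matrix A B C D $ Inl i $ Inr j' = B $ i $ j'"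
  "block_matrix A B C D $ Inr i' $ Inl j = C $ i' $ j" "block_matrix A B C D $ Inr i' $ Inr j' = D $ i' $ j'"
  by (simp_all add: block_matrix_def)

lemma mat_Inl_Inr [simp]:
  "mat 1 $ Inl i $ Inl j = mat 1 $ i $ j" "mat 1 $ Inr i' $ Inr j' = mat 1 $ i' $ j'"
  "mat 1 $ Inl i $ Inr j' = 0" "mat 1 $ Inr i' $ Inl j = 0"
  by (simp_all add: mat_def)

lemma mat_1_block:
  "(mat 1 :: complex ^ ('p::finite + 'q::finite) ^ ('p + 'q)) = block_matrix (mat 1) 0 0 (mat 1)"
  by (simp add: vec_eq_iff split_sum_all)

lemma block_matrix_diff:
  "block_matrix A B C D - block_matrix A' B' C' D'
    = block_matrix (A - A' :: 'a::group_add ^ _ ^ _) (B - B') (C - C') (D - D')"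
  by (simp add: vec_eq_iff split_sum_all)

lemma block_matrix_mult:
  fixes A :: "complex ^ 'p ^ 'p" and D :: "complex ^ 'q ^ 'q"
  shows "block_matrix A B C D ** block_matrix A' B' C' D'
    = block_matrix (A ** A' + B ** C') (A ** B' + B ** D') (C ** A' + D ** C') (C ** B' + D ** D')"
  by (simp add: vec_eq_iff split_sum_all matrix_matrix_mult_def sum_UNIV_sum)

lemma row_block_mult_block_matrix:
  fixes M :: "complex ^ 'p ^ 'm" and N :: "complex ^ 'q ^ 'm"
  shows "row_block M N ** block_matrix A B C D = row_block (M ** A + N ** C) (M ** B + N ** D)"
  by (simp add: vec_eq_iff split_sum_all matrix_matrix_mult_def sum_UNIV_sum)

lemma row_block_mult_col_block:
  fixes M :: "complex ^ 'p ^ 'm" and N :: "complex ^ 'q ^ 'm"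
  shows "row_block M N ** col_block P Q = M ** P + N ** Q"
  by (simp add: vec_eq_iff matrix_matrix_mult_def sum_UNIV_sum)

lemma col_block_mult_row_block:
  fixes M :: "complex ^ 'm ^ 'p" and N :: "complex ^ 'm ^ 'q"
  shows "col_block M N ** row_block P Q = block_matrix (M ** P) (M ** Q) (N ** P) (N ** Q)"
  by (simp add: vec_eq_iff split_sum_all matrix_matrix_mult_def)

lemma block_matrix_cases:
  obtains A B C D where "X = block_matrix A B C D"
proof
  show "X = block_matrix (\<chi> i j. X $ Inl i $ Inl j) (\<chi> i j. X $ Inl i $ Inr j)
      (\<chi> i j. X $ Inr i $ Inl j) (\<chi> i j. X $ Inr i $ Inr j)"
    by (simp add: vec_eq_iff split_sum_all)
qed

lemma block_matrix_inject:
  "block_matrix A B C D = block_matrix A' B' C' D' \<longleftrightarrow> A = A' \<and> B = B' \<and> C = C' \<and> D = D'"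
  by (auto simp: vec_eq_iff split_sum_all)

lemma matrix_mult_uminus: "(- A) ** M = - (A ** M)" "A ** (- M) = - (A ** M)"
  for A :: "complex ^ 'n ^ 'm"
  by (simp_all add: vec_eq_iff matrix_matrix_mult_def sum_negf)

text \<open>Stands in for the determinant formula for block triangular matrices: the top left block
  of a right inverse is a right inverse of \<open>M\<close>, and conversely an inverse can be
  written down by blocks.\<close>

lemma invertible_block_lower_iff:
  fixes M :: "complex ^ 'p ^ 'p" and X :: "complex ^ 'p ^ 'q"
  shows "invertible (block_matrix M 0 X (mat 1)) \<longleftrightarrow> invertible M"
proof
  assume "invertible (block_matrix M 0 X (mat 1))"
  then obtain Y where "block_matrix M 0 X (mat 1) ** Y = mat 1" unfolding invertible_def by blast
  then show "invertible M"
    by (cases Y rule: block_matrix_cases)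
      (auto simp: block_matrix_mult mat_1_block block_matrix_inject invertible_right_inverse)
next
  assume "invertible M"
  then obtain N where N: "M ** N = mat 1" unfolding invertible_def by blast
  have "block_matrix M 0 X (mat 1) ** block_matrix N 0 (- (X ** N)) (mat 1) = mat 1"
    by (simp add: block_matrix_mult N mat_1_block[symmetric])
  then show "invertible (block_matrix M 0 X (mat 1))" by (auto simp: invertible_right_inverse)
qed

text \<open>Here the bottom right block of a right inverse inverts \<open>M\<close>; the explicit
  inverse for the converse is checked from the left.\<close>

lemma invertible_block_upper_iff:
  fixes M :: "complex ^ 'q ^ 'q" and X :: "complex ^ 'q ^ 'p"
  shows "invertible (block_matrix (mat 1) X 0 M) \<longleftrightarrow> invertible M"
proof
  assume "invertible (block_matrix (mat 1) X 0 M)"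
  then obtain Y where "block_matrix (mat 1) X 0 M ** Y = mat 1" unfolding invertible_def by blast
  then show "invertible M"
    by (cases Y rule: block_matrix_cases)
      (auto simp: block_matrix_mult mat_1_block block_matrix_inject invertible_right_inverse)
next
  assume "invertible M"
  then obtain N where N: "N ** M = mat 1" unfolding invertible_def by blast
  have "block_matrix (mat 1) (- (X ** N)) 0 N ** block_matrix (mat 1) X 0 M = mat 1"
    by (simp add: block_matrix_mult N mat_1_block[symmetric] matrix_mult_uminus matrix_mul_assoc[symmetric])
  then show "invertible (block_matrix (mat 1) X 0 M)" by (auto simp: invertible_left_inverse)
qed

lemma L2_on_row_block:
  fixes f1 :: "real \<Rightarrow> complex ^ 'p ^ 'm" and f2 :: "real \<Rightarrow> complex ^ 'q ^ 'm"
  assumes "L2_on J f1" "L2_on J f2" "J \<in> sets lebesgue"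
  shows "L2_on J (\<lambda>x. row_block (f1 x) (f2 x))"
proof -
  have eq: "row_block M N = row_block M 0 + row_block 0 N" for M :: "complex ^ 'p ^ 'm" and N :: "complex ^ 'q ^ 'm"
    by (simp add: vec_eq_iff split_sum_all)
  have 1: "bounded_linear (\<lambda>M :: complex ^ 'p ^ 'm. row_block M (0 :: complex ^ 'q ^ 'm))"
    by (intro linear_conv_bounded_linear[THEN iffD1] linearI) (simp_all add: vec_eq_iff split_sum_all)
  have 2: "bounded_linear (\<lambda>N :: complex ^ 'q ^ 'm. row_block (0 :: complex ^ 'p ^ 'm) N)"
    by (intro linear_conv_bounded_linear[THEN iffD1] linearI) (simp_all add: vec_eq_iff split_sum_all)
  show ?thesis
    by (subst eq) (rule L2_on_add[OF L2_on_bounded_linear[OF 1 assms(1,3)] L2_on_bounded_linear[OF 2 assms(2,3)]])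
qed

lemma L2_on_col_block:
  fixes f1 :: "real \<Rightarrow> complex ^ 'm ^ 'p" and f2 :: "real \<Rightarrow> complex ^ 'm ^ 'q"
  assumes "L2_on J f1" "L2_on J f2" "J \<in> sets lebesgue"
  shows "L2_on J (\<lambda>x. col_block (f1 x) (f2 x))"
proof -
  have eq: "col_block M N = col_block M 0 + col_block 0 N" for M :: "complex ^ 'm ^ 'p" and N :: "complex ^ 'm ^ 'q"
    by (simp add: vec_eq_iff split_sum_all)
  have 1: "bounded_linear (\<lambda>M :: complex ^ 'm ^ 'p. col_block M (0 :: complex ^ 'm ^ 'q))"
    by (intro linear_conv_bounded_linear[THEN iffD1] linearI) (simp_all add: vec_eq_iff split_sum_all)
  have 2: "bounded_linear (\<lambda>N :: complex ^ 'm ^ 'q. col_block (0 :: complex ^ 'm ^ 'p) N)"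
    by (intro linear_conv_bounded_linear[THEN iffD1] linearI) (simp_all add: vec_eq_iff split_sum_all)
  show ?thesis
    by (subst eq) (rule L2_on_add[OF L2_on_bounded_linear[OF 1 assms(1,3)] L2_on_bounded_linear[OF 2 assms(2,3)]])
qed

lemma bounded_linear_nth_nth: "bounded_linear (\<lambda>M :: complex ^ 'l ^ 'k. M $ i $ j)"
  by (intro linear_conv_bounded_linear[THEN iffD1] linearI) simp_all

lemma set_integral_nth_nth:
  fixes f :: "'a \<Rightarrow> complex ^ 'l ^ 'k"
  assumes "set_integrable M S f"
  shows "(LINT x:S|M. f x) $ i $ j = (LINT x:S|M. f x $ i $ j)"
  using set_integral_bounded_linear(2)[OF bounded_linear_nth_nth assms] by simp

lemma set_integral_block_matrix:
  fixes A :: "real \<Rightarrow> complex ^ 'p ^ 'p" and D :: "real \<Rightarrow> complex ^ 'q ^ 'q"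
  assumes "set_integrable M S A" "set_integrable M S B" "set_integrable M S C" "set_integrable M S D"
    and "set_integrable M S (\<lambda>x. block_matrix (A x) (B x) (C x) (D x))"
  shows "(LINT x:S|M. block_matrix (A x) (B x) (C x) (D x))
    = block_matrix (LINT x:S|M. A x) (LINT x:S|M. B x) (LINT x:S|M. C x) (LINT x:S|M. D x)"
  using assms by (simp add: vec_eq_iff split_sum_all set_integral_nth_nth)

lemma mat_1_minus_P0_matrix:
  "mat 1 - P0_matrix = (block_matrix (mat 1) 0 0 0 :: complex ^ ('p::finite + 'q::finite) ^ ('p + 'q))"
  by (simp add: P0_matrix_def mat_1_block block_matrix_diff)

text \<open>This makes \<open>integral_operator_L_kernel\<close> applicable to both operators.\<close>

lemma K_kernel_eq_L_kernel:
  fixes f1 :: "real \<Rightarrow> complex ^ 'p ^ 'm" and f2 :: "real \<Rightarrow> complex ^ 'q ^ 'm"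
    and g1 :: "real \<Rightarrow> complex ^ 'm ^ 'p" and g2 :: "real \<Rightarrow> complex ^ 'm ^ 'q"
  shows "K_kernel f1 f2 g1 g2 = L_kernel (C_matrix f1 f2) (B_matrix g1 g2) (\<lambda>_. mat 1) P0_matrix"
  unfolding K_kernel_def L_kernel_def C_matrix_def B_matrix_def matrix_inv_mat_1 mat_1_minus_P0_matrix
  by (intro ext) (simp add: P0_matrix_def row_block_mult_block_matrix row_block_mult_col_block matrix_mult_uminus)

section \<open>The fundamental matrix built from the Volterra solutions\<close>

theorem lemma2p6:
  fixes a b :: ereal and \<alpha> :: complex
    and f1 :: "real \<Rightarrow> complex ^ 'n1 ^ 'm" and f2 :: "real \<Rightarrow> complex ^ 'n2 ^ 'm"
    and g1 :: "real \<Rightarrow> complex ^ 'm ^ 'n1" and g2 :: "real \<Rightarrow> complex ^ 'm ^ 'n2"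
    and fh1 :: "real \<Rightarrow> complex ^ 'n1 ^ 'm" and fh2 :: "real \<Rightarrow> complex ^ 'n2 ^ 'm"
  defines "J \<equiv> einterval a b"
  defines "H \<equiv> H_kernel f1 f2 g1 g2"
  defines "A \<equiv> A_matrix f1 f2 g1 g2"
  defines "B \<equiv> B_matrix g1 g2"
  defines "C \<equiv> C_matrix f1 f2"
  defines "K \<equiv> integral_operator J (K_kernel f1 f2 g1 g2)"
  defines "U \<equiv> U_matrix \<alpha> a b g1 g2 fh1 fh2"
  defines "L \<equiv> \<lambda>P. integral_operator J (L_kernel C B (\<lambda>x. U (ereal x)) P)"
  defines "det1_nz \<equiv> det (mat 1 - \<alpha> *\<^sub>c (LINT x:J|lebesgue. g1 x ** fh1 x)) \<noteq> 0"
  defines "det2_nz \<equiv> det (mat 1 - \<alpha> *\<^sub>c (LINT x:J|lebesgue. g2 x ** fh2 x)) \<noteq> 0"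
  assumes "a < b"
    and "L2_on J f1" and "L2_on J f2" and "L2_on J g1" and "L2_on J g2"
    and "L2_on J fh1" and "L2_on J fh2"
    and volterra1: "AE x\<in>J in lebesgue.
          fh1 x = f1 x - \<alpha> *\<^sub>c (LINT y:einterval (ereal x) b|lebesgue. H x y ** fh1 y)"
    and volterra2: "AE x\<in>J in lebesgue.
          fh2 x = f2 x + \<alpha> *\<^sub>c (LINT y:einterval a (ereal x)|lebesgue. H x y ** fh2 y)"
  shows "is_solution_on J \<alpha> A (\<lambda>x. U (ereal x)) \<and>
    (det1_nz \<longleftrightarrow> det2_nz) \<and>
    (det1_nz \<longrightarrow>
       (\<forall>x\<in>J. invertible (U (ereal x))) \<and>
       (\<forall>V. is_solution_on J \<alpha> A V \<longleftrightarrow> (\<exists>D. \<forall>x\<in>J. V x = U (ereal x) ** D))) \<and>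
    (det1_nz \<longrightarrow>
       (\<forall>P. P0_matrix ** U b ** (mat 1 - P) = (mat 1 - P0_matrix) ** U a ** P \<longleftrightarrow> P = P0_matrix) \<and>
       L2_inverse_operators J
         (\<lambda>\<phi> x. \<phi> x - \<alpha> *s K \<phi> x) (\<lambda>\<phi> x. \<phi> x + \<alpha> *s L P0_matrix \<phi> x))"
proof -
  define F where "F = (\<lambda>x. row_block (fh1 x) (fh2 x))"
  note L2 = \<open>L2_on J f1\<close> \<open>L2_on J f2\<close> \<open>L2_on J g1\<close> \<open>L2_on J g2\<close> \<open>L2_on J fh1\<close> \<open>L2_on J fh2\<close>
  note prod_int = set_integrable_L2_prod[OF bounded_bilinear_matrix_mult]
  have int: "set_integrable lebesgue (einterval s t) (\<lambda>y. g1 y ** fh1 y)"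
    "set_integrable lebesgue (einterval s t) (\<lambda>y. g1 y ** fh2 y)"
    "set_integrable lebesgue (einterval s t) (\<lambda>y. g2 y ** fh1 y)"
    "set_integrable lebesgue (einterval s t) (\<lambda>y. g2 y ** fh2 y)" if "a \<le> s" "t \<le> b" for s t
    using that L2[unfolded J_def] by (auto intro!: set_integrable_einterval_subset[OF prod_int])
  have g2': "L2_on J (\<lambda>x. - g2 x)"
    using L2_on_bounded_linear[OF bounded_linear_minus[OF bounded_linear_ident] L2(4)] by (simp add: J_def)
  have B_L2: "L2_on J B" unfolding B_def B_matrix_def by (intro L2_on_col_block L2 g2') (simp add: J_def)
  have C_L2: "L2_on J C" unfolding C_def C_matrix_def by (intro L2_on_row_block L2) (simp add: J_def)
  have F_L2: "L2_on J F" unfolding F_def by (intro L2_on_row_block L2) (simp add: J_def)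
  have A_eq: "A = (\<lambda>t. B t ** C t)" by (simp add: fun_eq_iff A_def A_matrix_def B_def C_def)
  have lin: "bounded_linear (\<lambda>X. M ** X)" for M :: "complex ^ 'k ^ 'm"
    by (rule bounded_bilinear.bounded_linear_right[OF bounded_bilinear_matrix_mult])
  \<comment> \<open>Semi-separability: the factors depending on \<open>x\<close> leave the integral,
    so the Volterra integrals are expressed by the integrals that make up \<open>U\<close>.\<close>
  have H_int: "(LINT y:einterval s t|lebesgue. H x y ** h y)
      = f1 x ** (LINT y:einterval s t|lebesgue. g1 y ** h y) - f2 x ** (LINT y:einterval s t|lebesgue. g2 y ** h y)"
    if i: "set_integrable lebesgue (einterval s t) (\<lambda>y. g1 y ** h y)" "set_integrable lebesgue (einterval s t) (\<lambda>y. g2 y ** h y)"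
    for s t x and h :: "real \<Rightarrow> complex ^ 'k ^ 'm"
  proof -
    have "(LINT y:einterval s t|lebesgue. H x y ** h y)
      = (LINT y:einterval s t|lebesgue. f1 x ** (g1 y ** h y) - f2 x ** (g2 y ** h y))"
      by (simp add: H_def H_kernel_def bounded_bilinear.diff_left[OF bounded_bilinear_matrix_mult] matrix_mul_assoc)
    also have "\<dots> = (LINT y:einterval s t|lebesgue. f1 x ** (g1 y ** h y)) - (LINT y:einterval s t|lebesgue. f2 x ** (g2 y ** h y))"
      by (intro set_integral_diff(2) set_integral_bounded_linear(1)[OF lin] i)
    finally show ?thesis
      by (simp add: set_integral_bounded_linear(2)[OF lin i(1)] set_integral_bounded_linear(2)[OF lin i(2)])
  qed
  have U_eq: "U x = block_matrix
      (mat 1 - \<alpha> *\<^sub>c (LINT y:einterval x b|lebesgue. g1 y ** fh1 y)) (\<alpha> *\<^sub>c (LINT y:einterval a x|lebesgue. g1 y ** fh2 y))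
      (\<alpha> *\<^sub>c (LINT y:einterval x b|lebesgue. g2 y ** fh1 y)) (mat 1 - \<alpha> *\<^sub>c (LINT y:einterval a x|lebesgue. g2 y ** fh2 y))" for x
    by (simp add: U_def U_matrix_def)
  have cz: "\<alpha> *\<^sub>c (0 :: complex ^ 'k ^ 'l) = 0" by (simp add: vec_eq_iff)
  \<comment> \<open>At \<open>a\<close> the integrals starting at \<open>a\<close> run over the
    empty interval, so the second block column is that of the identity; at \<open>b\<close> the same
    happens to the first.\<close>
  have Ua: "U a = block_matrix (mat 1 - \<alpha> *\<^sub>c (LINT y:J|lebesgue. g1 y ** fh1 y)) 0
      (\<alpha> *\<^sub>c (LINT y:J|lebesgue. g2 y ** fh1 y)) (mat 1)"
    by (simp add: U_eq einterval_same set_lebesgue_integral_def[of _ "{}"] J_def cz)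
  have Ub: "U b = block_matrix (mat 1) (\<alpha> *\<^sub>c (LINT y:J|lebesgue. g1 y ** fh2 y)) 0
      (mat 1 - \<alpha> *\<^sub>c (LINT y:J|lebesgue. g2 y ** fh2 y))"
    by (simp add: U_eq einterval_same set_lebesgue_integral_def[of _ "{}"] J_def cz)
  interpret fundamental_matrix a b \<alpha> B C F U P0_matrix
  proof
    show "a < b" by fact
    show "L2_on (einterval a b) B" "L2_on (einterval a b) C" "L2_on (einterval a b) F"
      using B_L2 C_L2 F_L2 by (simp_all add: J_def)
    \<comment> \<open>Multiplying out \<open>C U\<close> by blocks yields exactly the right-hand
      sides of the two Volterra equations.\<close>
    show "AE x\<in>einterval a b in lebesgue. F x = C x ** U (ereal x)"
      using volterra1 volterra2
    proof eventually_elim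
      case (elim x)
      show ?case
      proof
        assume x: "x \<in> einterval a b"
        then have ax: "a \<le> ereal x" "ereal x \<le> b" by (auto simp: einterval_iff)
        have e1: "fh1 x = f1 x - \<alpha> *\<^sub>c (f1 x ** (LINT y:einterval x b|lebesgue. g1 y ** fh1 y)
            - f2 x ** (LINT y:einterval x b|lebesgue. g2 y ** fh1 y))"
          using elim(1) x ax int H_int[of "ereal x" b fh1 x] by (simp add: J_def)
        have e2: "fh2 x = f2 x + \<alpha> *\<^sub>c (f1 x ** (LINT y:einterval a x|lebesgue. g1 y ** fh2 y)
            - f2 x ** (LINT y:einterval a x|lebesgue. g2 y ** fh2 y))"
          using elim(2) x ax int H_int[of a "ereal x" fh2 x] by (simp add: J_def)
        have cdiff: "\<alpha> *\<^sub>c (X - Y) = \<alpha> *\<^sub>c X - \<alpha> *\<^sub>c Y" for X Y :: "complex ^ 'k ^ 'm"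
          by (simp add: vec_eq_iff algebra_simps)
        show "F x = C x ** U (ereal x)"
          unfolding F_def e1 e2 cdiff
          by (simp add: C_def C_matrix_def U_eq row_block_mult_block_matrix cscale_matrix_mult
              bounded_bilinear.diff_right[OF bounded_bilinear_matrix_mult] algebra_simps)
      qed
    qed
    show "U y - U x = (LINT t:einterval x y|lebesgue. \<alpha> *\<^sub>c (B t ** F t))" if xy: "a \<le> x" "x \<le> y" "y \<le> b" for x y
    proof -
      have BF: "set_integrable lebesgue (einterval x y) (\<lambda>t. B t ** F t)"
        using prod_int[OF B_L2 F_L2] xy by (auto simp: J_def intro: set_integrable_einterval_subset)
      have BF_eq: "B t ** F t = block_matrix (g1 t ** fh1 t) (g1 t ** fh2 t) (- (g2 t ** fh1 t)) (- (g2 t ** fh2 t))" for t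
        by (simp add: B_def B_matrix_def F_def col_block_mult_row_block matrix_mult_uminus)
      have neg: "set_integrable lebesgue (einterval x y) (\<lambda>t. - h t)" "(LINT t:einterval x y|lebesgue. - h t) = - (LINT t:einterval x y|lebesgue. h t)"
        if "set_integrable lebesgue (einterval x y) h" for h :: "real \<Rightarrow> complex ^ 'k ^ 'l"
        using set_integral_bounded_linear[OF bounded_linear_minus[OF bounded_linear_ident] that] by simp_all
      note i = int[of x y, OF xy(1) xy(3)]
      have "(LINT t:einterval x y|lebesgue. \<alpha> *\<^sub>c (B t ** F t)) = \<alpha> *\<^sub>c (LINT t:einterval x y|lebesgue. B t ** F t)"
        by (rule set_integral_bounded_linear(2)[OF bounded_linear_cscale BF])
      also have "(LINT t:einterval x y|lebesgue. B t ** F t)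
        = block_matrix (LINT t:einterval x y|lebesgue. g1 t ** fh1 t) (LINT t:einterval x y|lebesgue. g1 t ** fh2 t)
           (- (LINT t:einterval x y|lebesgue. g2 t ** fh1 t)) (- (LINT t:einterval x y|lebesgue. g2 t ** fh2 t))"
        using BF unfolding BF_eq neg(2)[OF i(3), symmetric] neg(2)[OF i(4), symmetric]
        by (intro set_integral_block_matrix i neg(1))
      finally have rhs: "(LINT t:einterval x y|lebesgue. \<alpha> *\<^sub>c (B t ** F t)) = \<alpha> *\<^sub>c \<dots>" .
      \<comment> \<open>From \<open>x\<close> to \<open>y\<close>, integrals ending at
        \<open>b\<close> lose the integral over the interval between them, while those starting at
        \<open>a\<close> gain it; this accounts for the opposite signs in the two block columns of
        \<open>U\<close>.\<close>
      have comb: "(LINT t:einterval x b|lebesgue. h t) = (LINT t:einterval x y|lebesgue. h t) + (LINT t:einterval y b|lebesgue. h t)"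
        "(LINT t:einterval a y|lebesgue. h t) = (LINT t:einterval a x|lebesgue. h t) + (LINT t:einterval x y|lebesgue. h t)"
        if "set_integrable lebesgue (einterval a b) h" for h :: "real \<Rightarrow> complex ^ 'k ^ 'l"
        using xy by (intro set_integral_einterval_combine set_integrable_einterval_subset[OF that]; simp)+
      note ii = int[of a b, OF order_refl order_refl]
      show ?thesis
        unfolding rhs U_eq comb(1)[OF ii(1)] comb(1)[OF ii(3)] comb(2)[OF ii(2)] comb(2)[OF ii(4)] block_matrix_diff
        by (simp add: vec_eq_iff split_sum_all algebra_simps)
    qed
    show "P0_matrix ** P0_matrix = (P0_matrix :: complex ^ ('n1 + 'n2) ^ ('n1 + 'n2))"
      by (simp add: P0_matrix_def block_matrix_mult)
    show "U a ** P0_matrix = P0_matrix" by (simp add: Ua P0_matrix_def block_matrix_mult)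
    show "U b ** (mat 1 - P0_matrix) = mat 1 - P0_matrix" unfolding mat_1_minus_P0_matrix by (simp add: Ub block_matrix_mult)
  qed
  have det1: "det1_nz \<longleftrightarrow> invertible (U a)"
    unfolding det1_nz_def Ua invertible_block_lower_iff by (simp only: invertible_det_nz)
  have det2: "det2_nz \<longleftrightarrow> invertible (U b)"
    unfolding det2_nz_def Ub invertible_block_upper_iff by (simp only: invertible_det_nz)
  have "det1_nz \<longleftrightarrow> det2_nz" unfolding det1 det2 by (rule U_invertible_iff) (use \<open>a < b\<close> in auto)
  moreover have "is_solution_on J \<alpha> A (\<lambda>x. U (ereal x))"
    unfolding J_def A_eq by (rule U_solution)
  moreover have "(\<forall>x\<in>J. invertible (U (ereal x))) \<and>
       (\<forall>V. is_solution_on J \<alpha> A V \<longleftrightarrow> (\<exists>D. \<forall>x\<in>J. V x = U (ereal x) ** D)) \<and>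
       (\<forall>P. P0_matrix ** U b ** (mat 1 - P) = (mat 1 - P0_matrix) ** U a ** P \<longleftrightarrow> P = P0_matrix) \<and>
       L2_inverse_operators J
         (\<lambda>\<phi> x. \<phi> x - \<alpha> *s K \<phi> x) (\<lambda>\<phi> x. \<phi> x + \<alpha> *s L P0_matrix \<phi> x)" if det1_nz
  proof -
    interpret nonsingular_fundamental_matrix a b \<alpha> B C F U P0_matrix
      by unfold_locales (use that det1 in simp)
    have K_eq: "K = integral_operator J (L_kernel C B (\<lambda>_. mat 1) P0_matrix)"
      by (simp add: K_def K_kernel_eq_L_kernel B_def C_def)
    have ops: "(\<lambda>\<phi> x. \<phi> x - \<alpha> *s K \<phi> x) = one_minus_K" "(\<lambda>\<phi> x. \<phi> x + \<alpha> *s L P0_matrix \<phi> x) = one_plus_L"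
      by (intro ext, simp only: one_minus_K_def K_eq J_def) (intro ext, simp only: one_plus_L_def L_def J_def)
    show ?thesis
      unfolding ops unfolding J_def A_eq
      using U_invertible general_solution boundary_projection_unique operators_inverse by (auto simp: J_D)
  qed
  ultimately show ?thesis by blast
qed

end
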